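(* Let $n\ge 2$, let $A_1,\dots,A_d\in\mathfrak{so}(n)$ ($d\ge 1$), and let $B_{i_1j_1},\dots,B_{i_ej_e}$ be elements of the standard basis $\{B_{ij}=E_{ij}-E_{ji}:1\le i<j\le n\}$ of $\mathfrak{so}(n)$. Let $\mathrm{G}_{\rm drift}$ be the undirected graph on $\mathrm{V}=\{1,\dots,n\}$ in which $\{i,j\}$ ($i\neq j$) is an edge iff $[A_s]_{ij}=-[A_s]_{ji}\neq 0$ for some $s\in\{1,\dots,d\}$, and let $\mathrm{G}_{\rm contr}$ be the undirected graph on $\mathrm{V}$ with edge set $\{\{i_1,j_1\},\dots,\{i_e,j_e\}\}$. If each connected component of $\mathrm{G}_{\rm contr}$ contains at least three nodes and the union graph $\mathrm{G}_{\rm drift}\cup\mathrm{G}_{\rm contr}$ (same node set, union of edge sets) is connected, then the system $$\dot X(t)=\mathsf B_0X(t)+\Big(\sum_{i=1}^m u_i(t)\mathsf B_i\Big)X(t),\qquad X(0)=X_0,$$ is structurally controllable on $\mathrm{SO}(n)$ with respect to the pair of zero patterns $\big(\Sigma_{\rm r}(\{A_1,\dots,A_d\}),\Sigma_{\rm f}(\{B_{i_1j_1},\dots,B_{i_ej_e}\})\big)$.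
   Context: $E_{ij}$ denotes the $n\times n$ matrix with $(i,j)$ entry $1$ and all other entries $0$. For a finite subset $\{g_1,\dots,g_k\}$ of a real Lie algebra $\mathfrak g$, the free zero pattern is $\Sigma_{\rm f}(\{g_1,\dots,g_k\})=\{\sum_s l_sg_s: l_s\in\mathbb R\}$ and the rigid zero pattern is $\Sigma_{\rm r}(\{g_1,\dots,g_k\})=\{\sum_s l_sg_s: l_s\in\mathbb R,\ l_s\neq 0 \text{ for all } s\}$. For a connected matrix Lie group $\mathbf G$ with Lie algebra $\mathfrak g$, consider $\dot X=\mathsf B_0X+(\sum_{i=1}^m u_i\mathsf B_i)X$ with $X(t)\in\mathbf G$, $\mathsf B_i\in\mathfrak g$, and piecewise continuous real controls $u_i$. The attainable set $\mathcal R(I)$ is the set of all $X(T)$, $T\ge 0$, over all such controls, starting from $X(0)=I$. The system is controllable if $\mathcal R(I)=\mathbf G$ and accessible if $\mathcal R(I)$ has an interior point in $\mathbf G$. The system is structurally controllable (resp. accessible) on $\mathbf G$ with respect to a pair $(\Sigma_{\rm r}(\mathfrak g_\alpha),\Sigma_{\rm f}(\mathfrak g_\beta))$ if there exist an integer $m\ge1$, $\mathsf B_0\in\Sigma_{\rm r}(\mathfrak g_\alpha)$ and $\mathsf B_1,\dots,\mathsf B_m\in\Sigma_{\rm f}(\mathfrak g_\beta)$ such that the resulting system is controllable (resp. accessible) on $\mathbf G$. *)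

theory Defs
  imports "HOL-Analysis.Analysis"
begin

text \<open>n x n real matrices are rendered as real^'n^'n, with n = CARD('n);
  entry (i,j) is A $ i $ j. Indices carry a linear order (to express i < j).\<close>

definition so_alg :: "(real^'n^'n) set" where
  "so_alg = {A. transpose A = - A}"

definition SO_grp :: "(real^'n::finite^'n) set" where
  "SO_grp = {X. transpose X ** X = mat 1 \<and> det X = 1}"

text \<open>Standard basis element B_ij = E_ij - E_ji.\<close>
definition Bmat :: "'n \<Rightarrow> 'n \<Rightarrow> real^'n^'n" where
  "Bmat i j = (\<chi> a b. (if a = i \<and> b = j then 1 else 0) - (if a = j \<and> b = i then 1 else 0))"

definition free_pattern :: "(real^'n^'n) set \<Rightarrow> (real^'n^'n) set" where
  "free_pattern S = {(\<Sum>g\<in>S. l g *\<^sub>R g) | l. True}"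

definition rigid_pattern :: "(real^'n^'n) set \<Rightarrow> (real^'n^'n) set" where
  "rigid_pattern S = {(\<Sum>g\<in>S. l g *\<^sub>R g) | l. \<forall>g\<in>S. l g \<noteq> 0}"

text \<open>Piecewise continuity on [a,b]: finitely many break points, and on each
  open piece the function agrees with a function continuous on the closed piece.\<close>
definition pw_continuous_on :: "real \<Rightarrow> real \<Rightarrow> (real \<Rightarrow> real) \<Rightarrow> bool" where
  "pw_continuous_on a b u \<longleftrightarrow>
     (\<exists>S. finite S \<and> a \<in> S \<and> b \<in> S \<and> S \<subseteq> {a..b} \<and>
        (\<forall>s\<in>S. \<forall>t\<in>S. s < t \<and> {s<..<t} \<inter> S = {} \<longrightarrow>
           (\<exists>g. continuous_on {s..t} g \<and> (\<forall>x\<in>{s<..<t}. u x = g x))))"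

text \<open>Solution of dX = (B0 + sum_i u_i B_i) X on [0,T], X(0)=I, X(t) in SO(n):
  continuous, and differentiable satisfying the ODE except at finitely many times.\<close>
definition is_trajectory ::
  "real^'n::finite^'n \<Rightarrow> (real^'n^'n) list \<Rightarrow> (nat \<Rightarrow> real \<Rightarrow> real) \<Rightarrow> real
     \<Rightarrow> (real \<Rightarrow> real^'n^'n) \<Rightarrow> bool" where
  "is_trajectory B0 Bs u T X \<longleftrightarrow>
     0 \<le> T \<and> X 0 = mat 1 \<and> continuous_on {0..T} X \<and> (\<forall>t\<in>{0..T}. X t \<in> SO_grp) \<and>
     (\<exists>F. finite F \<and> (\<forall>t\<in>{0..T} - F.
        (X has_vector_derivative ((B0 + (\<Sum>i<length Bs. u i t *\<^sub>R (Bs ! i))) ** X t))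
          (at t within {0..T})))"

definition attainable :: "real^'n::finite^'n \<Rightarrow> (real^'n^'n) list \<Rightarrow> (real^'n^'n) set" where
  "attainable B0 Bs = {X T | T u X. 0 \<le> T \<and> (\<forall>i<length Bs. pw_continuous_on 0 T (u i))
                                  \<and> is_trajectory B0 Bs u T X}"

definition controllable_SO :: "real^'n::finite^'n \<Rightarrow> (real^'n^'n) list \<Rightarrow> bool" where
  "controllable_SO B0 Bs \<longleftrightarrow> attainable B0 Bs = SO_grp"

definition struct_controllable_SO :: "(real^'n::finite^'n) set \<Rightarrow> (real^'n^'n) set \<Rightarrow> bool" where
  "struct_controllable_SO Sa Sb \<longleftrightarrow>
     (\<exists>B0 Bs. length Bs \<ge> 1 \<and> B0 \<in> Sa \<and> set Bs \<subseteq> Sb \<and> controllable_SO B0 Bs)"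

text \<open>Graphs on the node set 'n as symmetric edge relations.\<close>
definition drift_rel :: "(real^'n^'n) set \<Rightarrow> ('n \<times> 'n) set" where
  "drift_rel As = {(i, j). i \<noteq> j \<and> (\<exists>A\<in>As. A $ i $ j \<noteq> 0)}"

definition contr_rel :: "('n \<times> 'n) set \<Rightarrow> ('n \<times> 'n) set" where
  "contr_rel P = P \<union> P\<inverse>"

definition component :: "('n \<times> 'n) set \<Rightarrow> 'n \<Rightarrow> 'n set" where
  "component R v = {w. (v, w) \<in> R\<^sup>*}"

definition graph_connected :: "('n \<times> 'n) set \<Rightarrow> bool" where
  "graph_connected R \<longleftrightarrow> (\<forall>v w. (v, w) \<in> R\<^sup>*)"

end

theory Submission
  imports Defs
begin

text \<open>
  Choose the drift \<open>B0\<close> in the rigid pattern so that none of its entries along an edge of the drift graph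
  vanishes, and use every allowed basis element as a control. The attainable set \<open>S\<close> is a semigroup.
  With large controls on short time intervals its closure \<open>G\<close> contains the rotations in the controlled
  planes; being a closed subsemigroup of a compact group, \<open>G\<close> is a group, and the matrices generating
  one-parameter subgroups of \<open>G\<close> form a vector space invariant under conjugation by \<open>G\<close>.
  Conjugating by quarter turns makes every control component a clique of controlled planes. If \<open>i\<close> and
  \<open>j\<close> lie in different components and \<open>B0 $ i $ j \<noteq> 0\<close>, half turns in two planes through \<open>i\<close>
  and two planes through \<open>j\<close> (this is where three nodes per component are needed) isolate a multiple of
  \<open>Bmat i j\<close> in \<open>B0\<close>. By connectedness all planes are controlled, so \<open>G\<close> is all of SO(n).

  To pass from density to equality, write rotations near the identity as products of plane rotations. Each
  factor is a uniform limit of continuous curves in \<open>S\<close>, so by Brouwer's fixed point theorem the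
  approximating products in \<open>S\<close> still cover a neighbourhood of the identity; a dense semigroup
  containing such a neighbourhood is everything.
\<close>

section \<open>The matrix exponential\<close>

text \<open>A wrapper on which \<open>*\<close> is the matrix product and the norm is the operator
  norm, so that the generic \<open>exp\<close> of Banach algebras applies; the product
  \<open>*\<close> of the vector type is entrywise.\<close>

typedef 'n sqmat = "UNIV :: (real^'n::finite^'n) set"
  morphisms mat_of sq ..

setup_lifting type_definition_sqmat

lemma onorm_matrix_le: "norm (A *v x) \<le> onorm ((*v) A) * norm x" for A :: "real^'n::finite^'n"
  by (rule onorm) (rule matrix_vector_mul_bounded_linear)

lemma matrix_add_rdistrib: "(A + B) ** C = A ** C + B ** C" for A B C :: "real^'n::finite^'n"
  by (vector matrix_matrix_mult_def sum.distrib[symmetric] field_simps)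

lemma bounded_bilinear_matrix_matrix_mult:
  "bounded_bilinear ((**) :: real^'n::finite^'n \<Rightarrow> real^'n^'n \<Rightarrow> real^'n^'n)"
  by (intro bilinear_conv_bounded_bilinear[THEN iffD1])
     (auto simp: bilinear_def linear_iff matrix_add_ldistrib matrix_add_rdistrib
        vec_eq_iff matrix_matrix_mult_def sum_distrib_left mult_ac
        distrib_left sum.distrib)

instantiation sqmat :: (finite) real_normed_algebra_1
begin

lift_definition zero_sqmat :: "'a sqmat" is 0 .
lift_definition one_sqmat :: "'a sqmat" is "mat 1" .
lift_definition plus_sqmat :: "'a sqmat \<Rightarrow> 'a sqmat \<Rightarrow> 'a sqmat" is "(+)" .
lift_definition minus_sqmat :: "'a sqmat \<Rightarrow> 'a sqmat \<Rightarrow> 'a sqmat" is "(-)" .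
lift_definition uminus_sqmat :: "'a sqmat \<Rightarrow> 'a sqmat" is uminus .
lift_definition times_sqmat :: "'a sqmat \<Rightarrow> 'a sqmat \<Rightarrow> 'a sqmat" is "(**)" .
lift_definition scaleR_sqmat :: "real \<Rightarrow> 'a sqmat \<Rightarrow> 'a sqmat" is "(*\<^sub>R)" .
lift_definition norm_sqmat :: "'a sqmat \<Rightarrow> real" is "\<lambda>A. onorm ((*v) A)" .
definition dist_sqmat :: "'a sqmat \<Rightarrow> 'a sqmat \<Rightarrow> real" where "dist_sqmat x y = norm (x - y)"
definition sgn_sqmat :: "'a sqmat \<Rightarrow> 'a sqmat" where "sgn_sqmat x = scaleR (inverse (norm x)) x"
definition uniformity_sqmat :: "('a sqmat \<times> 'a sqmat) filter" where
  "uniformity_sqmat = (INF e\<in>{0<..}. principal {(x, y). dist x y < e})"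
definition open_sqmat :: "'a sqmat set \<Rightarrow> bool" where
  "open_sqmat U = (\<forall>x\<in>U. \<forall>\<^sub>F (x', y) in uniformity. x' = x \<longrightarrow> y \<in> U)"

instance
proof
  fix x y z :: "'a sqmat" and a b :: real
  show "x + y + z = x + (y + z)" "x + y = y + x" "0 + x = x" "- x + x = 0" "x - y = x + - y"
    by (transfer, simp add: algebra_simps)+
  show "a *\<^sub>R (x + y) = a *\<^sub>R x + a *\<^sub>R y" "(a + b) *\<^sub>R x = a *\<^sub>R x + b *\<^sub>R x"
    "a *\<^sub>R b *\<^sub>R x = (a * b) *\<^sub>R x" "1 *\<^sub>R x = x"
    by (transfer, simp add: algebra_simps)+
  show "x * y * z = x * (y * z)" by transfer (simp add: matrix_mul_assoc)
  show "(x + y) * z = x * z + y * z" by transfer (simp add: matrix_add_rdistrib)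
  show "x * (y + z) = x * y + x * z" by transfer (simp add: matrix_add_ldistrib)
  show "a *\<^sub>R x * y = a *\<^sub>R (x * y)"
    by transfer (simp add: bounded_bilinear.scaleR_left[OF bounded_bilinear_matrix_matrix_mult])
  show "x * a *\<^sub>R y = a *\<^sub>R (x * y)"
    by transfer (simp add: bounded_bilinear.scaleR_right[OF bounded_bilinear_matrix_matrix_mult])
  show "1 * x = x" "x * 1 = x" by (transfer, simp)+
  show "(0 :: 'a sqmat) \<noteq> 1"
  proof (transfer, rule notI)
    assume "(0 :: real^'a^'a) = mat 1"
    then have "(0 :: real^'a^'a) $ undefined $ undefined = (mat 1 :: real^'a^'a) $ undefined $ undefined"
      by (rule arg_cong[where f = "\<lambda>A :: real^'a^'a. A $ undefined $ undefined"])
    then show False by (simp add: mat_def)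
  qed
  show "dist x y = norm (x - y)" by (fact dist_sqmat_def)
  show "sgn x = inverse (norm x) *\<^sub>R x" by (fact sgn_sqmat_def)
  show "(uniformity :: ('a sqmat \<times> 'a sqmat) filter) = (INF e\<in>{0<..}. principal {(x, y). dist x y < e})"
    by (fact uniformity_sqmat_def)
  show "open U = (\<forall>x\<in>U. \<forall>\<^sub>F (x', y) in uniformity. x' = x \<longrightarrow> y \<in> U)" for U :: "'a sqmat set"
    by (fact open_sqmat_def)
  show "(norm x = 0) = (x = 0)"
    by transfer (simp add: onorm_eq_0 matrix_eq matrix_vector_mul_bounded_linear)
  show "norm (x + y) \<le> norm x + norm y"
  proof transfer
    fix x y :: "real^'a^'a"
    have "(*v) (x + y) = (\<lambda>v. x *v v + y *v v)"
      by (auto simp: matrix_vector_mult_add_rdistrib)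
    then show "onorm ((*v) (x + y)) \<le> onorm ((*v) x) + onorm ((*v) y)"
      by (simp add: onorm_triangle matrix_vector_mul_bounded_linear)
  qed
  show "norm (a *\<^sub>R x) = \<bar>a\<bar> * norm x"
  proof transfer
    fix a and x :: "real^'a^'a"
    have "(*v) (a *\<^sub>R x) = (\<lambda>v. a *\<^sub>R (x *v v))"
      by (auto simp: scaleR_matrix_vector_assoc)
    then show "onorm ((*v) (a *\<^sub>R x)) = \<bar>a\<bar> * onorm ((*v) x)"
      by (simp add: onorm_scaleR matrix_vector_mul_bounded_linear)
  qed
  show "norm (x * y) \<le> norm x * norm y"
  proof transfer
    fix x y :: "real^'a^'a"
    have "(*v) (x ** y) = (*v) x \<circ> (*v) y"
      by (auto simp: matrix_vector_mul_assoc)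
    then show "onorm ((*v) (x ** y)) \<le> onorm ((*v) x) * onorm ((*v) y)"
      by (simp add: onorm_compose matrix_vector_mul_bounded_linear)
  qed
  show "norm (1 :: 'a sqmat) = 1"
  proof transfer
    have "(*v) (mat 1 :: real^'a^'a) = (\<lambda>x. x)" by auto
    then show "onorm ((*v) (mat 1 :: real^'a^'a)) = 1" by (simp add: onorm_id)
  qed
qed

end

lemma bounded_linear_sq: "bounded_linear (sq :: real^'n::finite^'n \<Rightarrow> _)"
  by (rule linear_conv_bounded_linear[THEN iffD1])
     (auto simp: linear_iff plus_sqmat.abs_eq scaleR_sqmat.abs_eq)

text \<open>Applying a matrix to a basis vector bounds each entry by the operator norm. Together
  with \<open>bounded_linear_sq\<close> this lets limits and derivatives pass between the two
  types.\<close>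

lemma bounded_linear_mat_of: "bounded_linear (mat_of :: 'n::finite sqmat \<Rightarrow> _)"
proof (rule bounded_linear_intro)
  fix x y :: "'n sqmat" and r
  show "mat_of (x + y) = mat_of x + mat_of y" by (fact plus_sqmat.rep_eq)
  show "mat_of (r *\<^sub>R x) = r *\<^sub>R mat_of x" by (fact scaleR_sqmat.rep_eq)
  have entry: "\<bar>mat_of x $ i $ j\<bar> \<le> norm x" for i j
  proof -
    have "\<bar>mat_of x $ i $ j\<bar> = \<bar>(mat_of x *v axis j 1) $ i\<bar>"
      by (simp add: matrix_vector_mult_basis column_def)
    also have "\<dots> \<le> norm (mat_of x *v axis j 1)" by (rule component_le_norm_cart)
    also have "\<dots> \<le> onorm ((*v) (mat_of x)) * norm (axis j (1::real))" by (rule onorm_matrix_le)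
    finally show ?thesis by (simp add: norm_sqmat.rep_eq)
  qed
  have "norm (mat_of x) \<le> (\<Sum>i\<in>UNIV. norm (mat_of x $ i))"
    by (simp add: norm_vec_def L2_set_le_sum)
  also have "\<dots> \<le> (\<Sum>i::'n\<in>UNIV. \<Sum>j::'n\<in>UNIV. norm x)"
    by (intro sum_mono order_trans[OF norm_le_l1_cart] entry)
  finally show "norm (mat_of x) \<le> norm x * (real CARD('n) * real CARD('n))" by (simp add: mult_ac)
qed

instance sqmat :: (finite) banach
proof
  fix X :: "nat \<Rightarrow> 'a sqmat"
  assume "Cauchy X"
  then have "Cauchy (\<lambda>n. mat_of (X n))"
    by (rule bounded_linear.Cauchy[OF bounded_linear_mat_of])
  then obtain L where "(\<lambda>n. mat_of (X n)) \<longlonglongrightarrow> L"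
    using Cauchy_convergent_iff convergent_def by blast
  then have "(\<lambda>n. sq (mat_of (X n))) \<longlonglongrightarrow> sq L"
    by (rule bounded_linear.tendsto[OF bounded_linear_sq])
  then show "convergent X" by (auto simp: mat_of_inverse convergent_def)
qed

definition mexp :: "real^'n::finite^'n \<Rightarrow> real^'n^'n" where
  "mexp A = mat_of (exp (sq A))"

lemma mexp_zero [simp]: "mexp 0 = mat 1"
  by (simp add: mexp_def one_sqmat.rep_eq flip: zero_sqmat_def)

text \<open>The exponential series converges uniformly on a ball containing \<open>x\<close>, by the
  Weierstrass test against the real series.\<close>

lemma isCont_exp_banach_algebra: "isCont exp (x :: 'a::{real_normed_algebra_1,banach})"
proof -
  define R where "R = norm x + 1"
  have "uniform_limit (ball 0 R) (\<lambda>n x :: 'a. \<Sum>i<n. x ^ i /\<^sub>R fact i)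
      (\<lambda>x. \<Sum>i. x ^ i /\<^sub>R fact i) sequentially"
  proof (rule Weierstrass_m_test)
    show "summable (\<lambda>n. R ^ n /\<^sub>R fact n)" by (rule summable_exp_generic)
    fix n and y :: 'a assume "y \<in> ball 0 R"
    then have "norm (y ^ n) \<le> R ^ n"
      by (intro order_trans[OF norm_power_ineq] power_mono) auto
    then show "norm (y ^ n /\<^sub>R fact n) \<le> R ^ n /\<^sub>R fact n"
      by (simp add: divide_simps)
  qed
  then have "continuous_on (ball 0 R) (\<lambda>x :: 'a. \<Sum>i. x ^ i /\<^sub>R fact i)"
    by (rule uniform_limit_theorem[rotated]) (auto intro!: continuous_intros always_eventually)
  then have "continuous_on (ball 0 R) (exp :: 'a \<Rightarrow> 'a)"
    by (simp add: exp_def[abs_def])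
  moreover have "x \<in> ball 0 R" by (simp add: R_def)
  ultimately show ?thesis by (simp add: continuous_on_eq_continuous_at)
qed

lemma continuous_on_mexp: "continuous_on S mexp"
proof -
  have "continuous_on UNIV (exp :: 'a sqmat \<Rightarrow> 'a sqmat)"
    by (simp add: continuous_on_eq_continuous_at isCont_exp_banach_algebra)
  then have "continuous_on S (\<lambda>A. exp (sq A) :: 'a sqmat)"
    using bounded_linear.continuous_on[OF bounded_linear_sq continuous_on_id]
    by (rule continuous_on_compose2) auto
  then show ?thesis
    unfolding mexp_def by (rule bounded_linear.continuous_on[OF bounded_linear_mat_of])
qed

lemma mexp_has_vector_derivative:
  "((\<lambda>t. mexp (t *\<^sub>R A)) has_vector_derivative A ** mexp (t *\<^sub>R A)) (at t)"
  using bounded_linear.has_vector_derivative[OF bounded_linear_mat_of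
      exp_scaleR_has_vector_derivative_left[of "sq A" t]]
  by (simp add: mexp_def times_sqmat.rep_eq sq_inverse flip: scaleR_sqmat.abs_eq)

lemma mexp_has_vector_derivative_right:
  "((\<lambda>t. mexp (t *\<^sub>R A)) has_vector_derivative mexp (t *\<^sub>R A) ** A) (at t)"
  using bounded_linear.has_vector_derivative[OF bounded_linear_mat_of
      exp_scaleR_has_vector_derivative_right[of "sq A" t]]
  by (simp add: mexp_def times_sqmat.rep_eq sq_inverse flip: scaleR_sqmat.abs_eq)

lemma mexp_add: "mexp ((s + t) *\<^sub>R A) = mexp (s *\<^sub>R A) ** mexp (t *\<^sub>R A)"
proof -
  have "exp ((s + t) *\<^sub>R sq A) = exp (s *\<^sub>R sq A) * exp (t *\<^sub>R sq A)"
    by (subst exp_add_commuting[symmetric]) (auto simp: scaleR_add_left)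
  then show ?thesis by (simp add: mexp_def times_sqmat.rep_eq flip: scaleR_sqmat.abs_eq)
qed

lemma mexp_inverse: "mexp (- A) ** mexp A = mat 1"
  using mexp_add[of "-1" 1 A] by simp

text \<open>Multiplying a solution by the backward flow gives a curve with zero derivative. Later
  identities for \<open>mexp\<close> are obtained by checking that a candidate solves the
  equation.\<close>

lemma mexp_unique:
  fixes X :: "real \<Rightarrow> real^'n::finite^'n"
  assumes X0: "X 0 = mat 1"
    and X: "\<And>t. (X has_vector_derivative A ** X t) (at t)"
  shows "X t = mexp (t *\<^sub>R A)"
proof -
  define Y where "Y s = mexp (s *\<^sub>R (- A)) ** X s" for s
  have "(Y has_vector_derivative 0) (at s)" for s
  proof -
    have "(Y has_vector_derivative mexp (s *\<^sub>R (- A)) ** (A ** X s) + mexp (s *\<^sub>R (- A)) ** (- A) ** X s) (at s)"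
      unfolding Y_def
      by (rule bounded_bilinear.has_vector_derivative[OF bounded_bilinear_matrix_matrix_mult
            mexp_has_vector_derivative_right X])
    moreover have "mexp (s *\<^sub>R (- A)) ** (A ** X s) + mexp (s *\<^sub>R (- A)) ** (- A) ** X s = 0"
      by (simp add: matrix_mul_assoc bounded_bilinear.minus_right[OF bounded_bilinear_matrix_matrix_mult]
          bounded_bilinear.minus_left[OF bounded_bilinear_matrix_matrix_mult])
    ultimately show ?thesis by simp
  qed
  then obtain c where c: "\<And>s. Y s = c"
    using has_vector_derivative_zero_constant[of UNIV Y] by (auto simp: convex_UNIV)
  have "Y t = Y 0" by (simp add: c)
  then have *: "mexp (- (t *\<^sub>R A)) ** X t = mat 1" by (simp add: Y_def X0)
  have "mexp (t *\<^sub>R A) ** mexp (- (t *\<^sub>R A)) = mat 1"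
    using mexp_inverse[of "- (t *\<^sub>R A)"] by simp
  then have "X t = mexp (t *\<^sub>R A) ** (mexp (- (t *\<^sub>R A)) ** X t)"
    by (simp add: matrix_mul_assoc)
  then show ?thesis by (simp add: *)
qed

lemmas matrix_bilinear_simps =
  bounded_bilinear.minus_left[OF bounded_bilinear_matrix_matrix_mult]
  bounded_bilinear.minus_right[OF bounded_bilinear_matrix_matrix_mult]
  bounded_bilinear.diff_left[OF bounded_bilinear_matrix_matrix_mult]
  bounded_bilinear.diff_right[OF bounded_bilinear_matrix_matrix_mult]
  bounded_bilinear.scaleR_left[OF bounded_bilinear_matrix_matrix_mult]
  bounded_bilinear.scaleR_right[OF bounded_bilinear_matrix_matrix_mult]

lemmas has_vector_derivative_matrix_mult =
  bounded_bilinear.has_vector_derivative[OF bounded_bilinear_matrix_matrix_mult]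

lemmas continuous_on_matrix_mult [continuous_intros] =
  bounded_bilinear.continuous_on[OF bounded_bilinear_matrix_matrix_mult]

lemmas tendsto_matrix_mult [tendsto_intros] =
  bounded_bilinear.tendsto[OF bounded_bilinear_matrix_matrix_mult]

lemma bounded_linear_transpose: "bounded_linear (transpose :: real^'n::finite^'n \<Rightarrow> real^'n^'n)"
  by (rule linear_conv_bounded_linear[THEN iffD1])
     (auto simp: linear_iff transpose_scalar, auto simp: transpose_def vec_eq_iff)

lemma mexp_conj:
  fixes g h :: "real^'n::finite^'n"
  assumes "h ** g = mat 1"
  shows "g ** mexp A ** h = mexp (g ** A ** h)"
proof -
  have gh: "g ** h = mat 1" using assms matrix_left_right_inverse by blast
  define X where "X t = g ** mexp (t *\<^sub>R A) ** h" for t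
  have "X 1 = mexp (1 *\<^sub>R (g ** A ** h))"
  proof (rule mexp_unique)
    show "X 0 = mat 1" by (simp add: X_def gh)
    fix t
    have "(X has_vector_derivative g ** (A ** mexp (t *\<^sub>R A)) ** h) (at t)"
      unfolding X_def
      using has_vector_derivative_matrix_mult[OF has_vector_derivative_matrix_mult[OF
          has_vector_derivative_const mexp_has_vector_derivative] has_vector_derivative_const]
      by simp
    moreover have "g ** (A ** mexp (t *\<^sub>R A)) ** h = g ** A ** (h ** g) ** mexp (t *\<^sub>R A) ** h"
      by (simp add: assms matrix_mul_assoc)
    ultimately show "(X has_vector_derivative g ** A ** h ** X t) (at t)"
      by (simp add: X_def matrix_mul_assoc)
  qed
  then show ?thesis by (simp add: X_def)
qed

lemma transpose_mexp: "transpose (mexp A) = mexp (transpose A)"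
proof -
  define X where "X t = transpose (mexp (t *\<^sub>R A))" for t
  have "X 1 = mexp (1 *\<^sub>R transpose A)"
  proof (rule mexp_unique)
    show "X 0 = mat 1" by (simp add: X_def)
    fix t
    show "(X has_vector_derivative transpose A ** X t) (at t)"
      using bounded_linear.has_vector_derivative[OF bounded_linear_transpose
          mexp_has_vector_derivative_right[of A t]]
      by (simp add: X_def[abs_def] matrix_transpose_mul)
  qed
  then show ?thesis by (simp add: X_def)
qed

section \<open>The special orthogonal group\<close>

lemma SO_one [simp]: "mat 1 \<in> SO_grp"
  by (simp add: SO_grp_def)

lemma SO_mult: "X \<in> SO_grp \<Longrightarrow> Y \<in> SO_grp \<Longrightarrow> X ** Y \<in> SO_grp"
  using orthogonal_matrix_mul[of X Y] by (auto simp: SO_grp_def orthogonal_matrix det_mul)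

lemma SO_left_inverse: "X \<in> SO_grp \<Longrightarrow> transpose X ** X = mat 1"
  by (simp add: SO_grp_def)

lemma SO_right_inverse: "X \<in> SO_grp \<Longrightarrow> X ** transpose X = mat 1"
  by (simp add: SO_grp_def matrix_left_right_inverse)

lemma SO_transpose: "X \<in> SO_grp \<Longrightarrow> transpose X \<in> SO_grp"
  using SO_right_inverse by (auto simp: SO_grp_def)

lemma SO_norm_mult_vec:
  assumes "X \<in> SO_grp"
  shows "norm (X *v v) = norm v"
proof -
  have "(X *v v) \<bullet> (X *v v) = v \<bullet> ((transpose X ** X) *v v)"
    by (metis dot_lmul_matrix inner_commute matrix_vector_mul_assoc transpose_matrix_vector)
  then show ?thesis using assms by (simp add: SO_left_inverse norm_eq_sqrt_inner)
qed

lemma norm_sq_SO: "X \<in> SO_grp \<Longrightarrow> norm (sq X) \<le> 1"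
  by (simp add: norm_sqmat.abs_eq) (rule onorm_le, simp add: SO_norm_mult_vec)

lemma continuous_on_det: "continuous_on S (det :: real^'n::finite^'n \<Rightarrow> real)"
  unfolding det_def by (intro continuous_intros)

lemma compact_SO: "compact (SO_grp :: (real^'n::finite^'n) set)"
proof -
  have "continuous_on UNIV (\<lambda>X :: real^'n^'n. (transpose X ** X, det X))"
    by (intro continuous_intros continuous_on_det bounded_linear.continuous_on[OF bounded_linear_transpose])
  then have "closed ((\<lambda>X :: real^'n^'n. (transpose X ** X, det X)) -` {(mat 1, 1)})"
    by (intro continuous_closed_vimage) (auto simp: continuous_on_eq_continuous_at)
  then have "closed (SO_grp :: (real^'n^'n) set)"
    by (simp add: SO_grp_def vimage_def)
  moreover have "bounded (SO_grp :: (real^'n^'n) set)"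
  proof -
    obtain K where K: "K > 0" "\<And>x :: 'n sqmat. norm (mat_of x) \<le> norm x * K"
      using bounded_linear.pos_bounded[OF bounded_linear_mat_of] by auto
    have "norm X \<le> K" if "X \<in> SO_grp" for X :: "real^'n^'n"
    proof -
      have "norm (mat_of (sq X)) \<le> norm (sq X) * K" by (rule K)
      also have "\<dots> \<le> 1 * K" using norm_sq_SO[OF that] K by (intro mult_right_mono) auto
      finally show ?thesis by (simp add: sq_inverse)
    qed
    then show ?thesis by (auto simp: bounded_iff)
  qed
  ultimately show ?thesis by (simp add: compact_eq_bounded_closed)
qed

lemma so_alg_scaleR: "A \<in> so_alg \<Longrightarrow> c *\<^sub>R A \<in> so_alg"
  by (simp add: so_alg_def transpose_scalar)

lemma so_alg_add: "A \<in> so_alg \<Longrightarrow> B \<in> so_alg \<Longrightarrow> A + B \<in> so_alg"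
  by (simp add: so_alg_def linear_add[OF bounded_linear.linear[OF bounded_linear_transpose]])

lemma so_alg_sum: "(\<And>i. i \<in> I \<Longrightarrow> f i \<in> so_alg) \<Longrightarrow> sum f I \<in> so_alg"
proof (induction I rule: infinite_finite_induct)
  case (insert x F)
  then show ?case by (simp add: so_alg_add)
qed (auto simp: so_alg_def transpose_def vec_eq_iff)

lemma so_alg_conj: "A \<in> so_alg \<Longrightarrow> g ** A ** transpose g \<in> so_alg" for g :: "real^'n::finite^'n"
  by (simp add: so_alg_def matrix_transpose_mul matrix_mul_assoc matrix_bilinear_simps)

lemma so_alg_nth: "A \<in> so_alg \<Longrightarrow> A $ i $ j = - A $ j $ i"
proof -
  assume "A \<in> so_alg"
  then have "transpose A $ j $ i = (- A) $ j $ i" by (simp add: so_alg_def)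
  then show ?thesis by (simp add: transpose_def)
qed

lemma transpose_mexp_skew: "A \<in> so_alg \<Longrightarrow> transpose (mexp A) = mexp (- A)"
  by (simp add: transpose_mexp so_alg_def)

lemma mexp_SO:
  assumes "A \<in> so_alg"
  shows "mexp A \<in> SO_grp"
proof -
  have orth: "transpose (mexp B) ** mexp B = mat 1" if "B \<in> so_alg" for B :: "real^'a^'a"
    using that by (simp add: transpose_mexp so_alg_def mexp_inverse)
  \<comment> \<open>Orthogonality alone leaves the determinant \<open>1\<close> or
    \<open>-1\<close>; writing \<open>mexp A\<close> as the square of an orthogonal matrix excludes
    \<open>-1\<close>.\<close>
  have half: "(1/2) *\<^sub>R A \<in> so_alg" by (intro so_alg_scaleR assms)
  have "mexp A = mexp ((1/2) *\<^sub>R A) ** mexp ((1/2) *\<^sub>R A)"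
    using mexp_add[of "1/2" "1/2" A] by simp
  then have "det (mexp A) = det (mexp ((1/2) *\<^sub>R A)) * det (mexp ((1/2) *\<^sub>R A))"
    by (simp add: det_mul)
  also have "\<dots> = 1"
    using det_orthogonal_matrix[of "mexp ((1/2) *\<^sub>R A)"] orth[OF half] by (auto simp: orthogonal_matrix)
  finally show ?thesis using orth[OF assms] by (simp add: SO_grp_def)
qed

lemma mexp_of_nat: "mexp (real k *\<^sub>R A) = mat_of (sq (mexp A) ^ k)"
proof (induction k)
  case (Suc k)
  then show ?case
    using mexp_add[of 1 "real k" A] by (simp add: times_sqmat.rep_eq sq_inverse)
qed (simp add: one_sqmat.rep_eq)

section \<open>Powers of rotations close to the identity\<close>

lemma has_vector_derivative_sequence:
  assumes "(f has_vector_derivative D) (at 0)"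
  shows "(\<lambda>k. real k *\<^sub>R (f (1 / real k) - f 0)) \<longlonglongrightarrow> D"
proof -
  have "((\<lambda>h. norm (f h - f 0 - h *\<^sub>R D) / norm h) \<longlongrightarrow> 0) (at 0)"
    using assms by (simp add: has_vector_derivative_def has_derivative_at)
  moreover have "filterlim (\<lambda>k. 1 / real k) (at 0) sequentially"
    by (auto simp: filterlim_at lim_1_over_n eventually_at_top_dense intro!: exI[of _ 0])
  ultimately have "(\<lambda>k. norm (f (1 / real k) - f 0 - (1 / real k) *\<^sub>R D) / norm (1 / real k)) \<longlonglongrightarrow> 0"
    by (rule filterlim_compose)
  moreover have "\<forall>\<^sub>F k in sequentially. norm (f (1 / real k) - f 0 - (1 / real k) *\<^sub>R D) / norm (1 / real k)
      = norm (real k *\<^sub>R (f (1 / real k) - f 0) - D)"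
  proof (rule eventually_sequentiallyI[of 1])
    fix k :: nat assume "k \<ge> 1"
    then have "real k *\<^sub>R (f (1 / real k) - f 0) - D = real k *\<^sub>R (f (1 / real k) - f 0 - (1 / real k) *\<^sub>R D)"
      by (simp add: scaleR_right_diff_distrib)
    then have "norm (real k *\<^sub>R (f (1 / real k) - f 0) - D) = real k * norm (f (1 / real k) - f 0 - (1 / real k) *\<^sub>R D)"
      by simp
    then show "norm (f (1 / real k) - f 0 - (1 / real k) *\<^sub>R D) / norm (1 / real k)
      = norm (real k *\<^sub>R (f (1 / real k) - f 0) - D)" by simp
  qed
  ultimately have "(\<lambda>k. norm (real k *\<^sub>R (f (1 / real k) - f 0) - D)) \<longlonglongrightarrow> 0"
    by (rule Lim_transform_eventually)
  then show ?thesis by (simp add: tendsto_norm_zero_iff LIM_zero_iff)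
qed

text \<open>Telescoping one factor at a time: the factors on either side of \<open>z - w\<close>
  have norm at most 1.\<close>

lemma norm_power_diff_noncomm:
  fixes z w :: "'a::real_normed_algebra_1"
  assumes z: "norm z \<le> 1" and w: "norm w \<le> 1"
  shows "norm (z ^ m - w ^ m) \<le> real m * norm (z - w)"
proof (induction m)
  case (Suc m)
  have "norm (z ^ m) \<le> 1"
    by (rule order_trans[OF norm_power_ineq power_le_one[OF norm_ge_zero z]])
  then have "norm (z ^ m * (z - w)) \<le> norm (z - w)"
    by (intro order_trans[OF norm_mult_ineq] mult_left_le_one_le) auto
  moreover have "norm ((z ^ m - w ^ m) * w) \<le> norm (z ^ m - w ^ m)"
    by (intro order_trans[OF norm_mult_ineq] mult_right_le_one_le w) auto
  moreover have eq: "z ^ Suc m - w ^ Suc m = z ^ m * (z - w) + (z ^ m - w ^ m) * w"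
    by (simp add: algebra_simps power_commutes)
  ultimately have "norm (z ^ Suc m - w ^ Suc m) \<le> norm (z - w) + norm (z ^ m - w ^ m)"
    unfolding eq by (intro norm_triangle_le add_mono)
  then show ?case using Suc by (simp add: algebra_simps)
qed simp

text \<open>Rotations have operator norm 1, so the error of each factor is not amplified by the power.\<close>

lemma SO_power_tendsto_mexp:
  fixes A :: "real^'n::finite^'n"
  assumes A: "A \<in> so_alg" and g: "\<And>k. g k \<in> SO_grp"
    and lim: "(\<lambda>k. real k *\<^sub>R (g k - mat 1)) \<longlonglongrightarrow> A"
  shows "(\<lambda>k. mat_of (sq (g k) ^ k)) \<longlonglongrightarrow> mexp A"
proof -
  \<comment> \<open>The exact \<open>k\<close>-th root of \<open>mexp A\<close>, against which
    \<open>g k\<close> is compared. At \<open>k = 0\<close> the division yields \<open>0\<close>, so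
    the root property is used only from \<open>k = 1\<close> on.\<close>
  define e where "e k = mexp ((1 / real k) *\<^sub>R A)" for k
  have eSO: "e k \<in> SO_grp" for k unfolding e_def by (intro mexp_SO so_alg_scaleR A)
  have "((\<lambda>t. mexp (t *\<^sub>R A)) has_vector_derivative A) (at 0)"
    using mexp_has_vector_derivative[of A 0] by simp
  from has_vector_derivative_sequence[OF this]
  have "(\<lambda>k. real k *\<^sub>R (e k - mat 1)) \<longlonglongrightarrow> A" by (simp add: e_def)
  from tendsto_diff[OF lim this]
  have "(\<lambda>k. real k *\<^sub>R (g k - e k)) \<longlonglongrightarrow> 0" by (simp add: algebra_simps)
  from bounded_linear.tendsto_zero[OF bounded_linear_sq this]
  have lim0: "(\<lambda>k. norm (sq (real k *\<^sub>R (g k - e k)))) \<longlonglongrightarrow> 0" by (rule tendsto_norm_zero)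
  have "(\<lambda>k. sq (g k) ^ k - sq (e k) ^ k) \<longlonglongrightarrow> 0"
  proof (rule Lim_null_comparison[OF _ lim0], rule always_eventually, rule allI)
    fix k
    have "norm (sq (g k) ^ k - sq (e k) ^ k) \<le> real k * norm (sq (g k) - sq (e k))"
      by (intro norm_power_diff_noncomm norm_sq_SO g eSO)
    also have "\<dots> = norm (sq (real k *\<^sub>R (g k - e k)))"
      by (simp only: scaleR_sqmat.abs_eq[symmetric] minus_sqmat.abs_eq[symmetric] norm_scaleR abs_of_nat)
    finally show "norm (sq (g k) ^ k - sq (e k) ^ k) \<le> norm (sq (real k *\<^sub>R (g k - e k)))" .
  qed
  from bounded_linear.tendsto_zero[OF bounded_linear_mat_of this]
  have "(\<lambda>k. mat_of (sq (g k) ^ k) - mat_of (sq (e k) ^ k)) \<longlonglongrightarrow> 0"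
    by (simp add: minus_sqmat.rep_eq)
  moreover have "(\<lambda>k. mat_of (sq (e k) ^ k)) \<longlonglongrightarrow> mexp A"
  proof (rule tendsto_eventually, rule eventually_sequentiallyI[of 1])
    fix k :: nat assume "k \<ge> 1"
    then show "mat_of (sq (e k) ^ k) = mexp A"
      unfolding e_def by (simp flip: mexp_of_nat)
  qed
  ultimately show ?thesis
    using tendsto_add by fastforce
qed

section \<open>Plane rotations\<close>

lemma Bmat_so_alg: "Bmat i j \<in> so_alg"
proof -
  have "transpose (Bmat i j) $ a $ b = (- Bmat i j) $ a $ b" for a b
    unfolding transpose_def Bmat_def uminus_vec_def vec_lambda_beta minus_diff_eq conj_commute[of "b = _"] ..
  then show ?thesis by (simp only: so_alg_def vec_eq_iff mem_Collect_eq) blast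
qed

lemma Bmat_swap: "Bmat j i = - Bmat i j"
  by (auto simp: Bmat_def vec_eq_iff)

lemma Bmat_mult_nth:
  fixes X :: "real^'n::finite^'n"
  shows "(Bmat i j ** X) $ a $ b = (if a = i then X $ j $ b else 0) - (if a = j then X $ i $ b else 0)"
proof -
  have "(Bmat i j ** X) $ a $ b = (\<Sum>k\<in>UNIV. (if k = j then (if a = i then X $ k $ b else 0) else 0)
      - (if k = i then (if a = j then X $ k $ b else 0) else 0))"
    unfolding matrix_matrix_mult_def Bmat_def by (auto intro!: sum.cong)
  then show ?thesis by (simp add: sum_subtractf)
qed

lemma mult_Bmat_nth:
  fixes X :: "real^'n::finite^'n"
  shows "(X ** Bmat i j) $ a $ b = (if b = j then X $ a $ i else 0) - (if b = i then X $ a $ j else 0)"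
proof -
  have "(X ** Bmat i j) $ a $ b = (\<Sum>k\<in>UNIV. (if k = i then (if b = j then X $ a $ k else 0) else 0)
      - (if k = j then (if b = i then X $ a $ k else 0) else 0))"
    unfolding matrix_matrix_mult_def Bmat_def by (auto intro!: sum.cong)
  then show ?thesis by (simp add: sum_subtractf)
qed

lemma conj_Bmat_nth:
  fixes g :: "real^'n::finite^'n"
  shows "(g ** Bmat i j ** transpose g) $ a $ b = g $ a $ i * g $ b $ j - g $ a $ j * g $ b $ i"
proof -
  have "(g ** Bmat i j ** transpose g) $ a $ b
      = (\<Sum>k\<in>UNIV. (if k = j then g $ a $ i * g $ b $ k else 0) - (if k = i then g $ a $ j * g $ b $ k else 0))"
    unfolding matrix_matrix_mult_def[of "g ** Bmat i j"]
    by (auto intro!: sum.cong simp: mult_Bmat_nth transpose_def)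
  then show ?thesis by (simp add: sum_subtractf)
qed

definition givens :: "'n::finite \<Rightarrow> 'n \<Rightarrow> real \<Rightarrow> real^'n^'n" where
  "givens i j t = mexp (t *\<^sub>R Bmat i j)"

lemma givens_SO: "givens i j t \<in> SO_grp"
  unfolding givens_def by (intro mexp_SO so_alg_scaleR Bmat_so_alg)

definition plane_proj :: "'n \<Rightarrow> 'n \<Rightarrow> real^'n^'n" where
  "plane_proj i j = (\<chi> a b. if a = b then if a = i \<or> a = j then 1 else 0 else 0)"

text \<open>For \<open>i \<noteq> j\<close> the generator satisfies \<open>B ** B = - P\<close> with
  \<open>P\<close> the projection onto its plane, and \<open>B ** P = B\<close>; hence the
  right-hand side solves the defining differential equation.\<close>

lemma givens_eq:
  assumes "i \<noteq> j"
  shows "givens i j t = mat 1 + (cos t - 1) *\<^sub>R plane_proj i j + sin t *\<^sub>R Bmat i j"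
proof -
  define X where "X t = mat 1 + (cos t - 1) *\<^sub>R plane_proj i j + sin t *\<^sub>R Bmat i j" for t
  have "X t = mexp (t *\<^sub>R Bmat i j)"
  proof (rule mexp_unique)
    show "X 0 = mat 1" by (simp add: X_def)
    fix t
    have "(X has_vector_derivative - sin t *\<^sub>R plane_proj i j + cos t *\<^sub>R Bmat i j) (at t)"
      unfolding X_def by (auto intro!: derivative_eq_intros)
    moreover have "Bmat i j ** plane_proj i j = Bmat i j"
      using assms by (auto simp: vec_eq_iff Bmat_mult_nth) (auto simp: plane_proj_def Bmat_def)
    moreover have "Bmat i j ** Bmat i j = - plane_proj i j"
      using assms by (auto simp: vec_eq_iff Bmat_mult_nth) (auto simp: plane_proj_def Bmat_def)
    ultimately show "(X has_vector_derivative Bmat i j ** X t) (at t)"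
      by (simp add: X_def matrix_add_ldistrib matrix_bilinear_simps algebra_simps)
  qed
  then show ?thesis by (simp add: X_def givens_def)
qed

lemma givens_nth:
  assumes "i \<noteq> j"
  shows "givens i j t $ a $ b = (if a = b then if a = i \<or> a = j then cos t else 1
    else if a = i \<and> b = j then sin t else if a = j \<and> b = i then - sin t else 0)"
  using assms by (auto simp: givens_eq mat_def plane_proj_def Bmat_def)

text \<open>The quarter turn sends the \<open>j\<close>-th basis vector to the \<open>k\<close>-th
  and fixes the \<open>i\<close>-th; the negative angle makes the sign come out positive.\<close>

lemma givens_conj_Bmat:
  assumes "i \<noteq> j" "j \<noteq> k" "i \<noteq> k"
  shows "givens j k (- (pi / 2)) ** Bmat i j ** transpose (givens j k (- (pi / 2))) = Bmat i k"
  using assms by (auto simp: vec_eq_iff conj_Bmat_nth givens_nth) (auto simp: Bmat_def)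

text \<open>A half turn is the diagonal matrix with \<open>-1\<close> at \<open>p\<close> and
  \<open>q\<close> and \<open>1\<close> elsewhere.\<close>

lemma givens_pi_conj_nth:
  assumes "p \<noteq> q"
  shows "(givens p q pi ** A ** transpose (givens p q pi)) $ a $ b =
    (if a = p \<or> a = q then - 1 else 1) * (if b = p \<or> b = q then - 1 else 1) * A $ a $ b"
proof -
  define s where "s a = (if a = p \<or> a = q then - 1 else 1 :: real)" for a
  have D: "givens p q pi $ a $ b = (if a = b then s a else 0)" for a b
    using assms by (simp add: givens_nth s_def)
  have "(givens p q pi ** A) $ a $ b = s a * A $ a $ b" for a b
    by (simp add: matrix_matrix_mult_def D if_distrib[where f = "\<lambda>x. x * _"] cong: if_cong)
  then have "(givens p q pi ** A ** transpose (givens p q pi)) $ a $ b = s a * A $ a $ b * s b"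
    unfolding matrix_matrix_mult_def[of "givens p q pi ** A"]
    by (simp add: transpose_def D if_distrib[where f = "\<lambda>x. _ * x"] cong: if_cong)
  then show ?thesis by (simp add: s_def)
qed

section \<open>Closed subsemigroups of the rotation group\<close>

text \<open>To be used for the closure of the attainable set. Time runs only forwards there, so
  inverses are derived from compactness and not assumed.\<close>

locale closed_rotation_semigroup =
  fixes G :: "(real^'n::finite^'n) set"
  assumes sub: "G \<subseteq> SO_grp" and closed: "closed G" and one: "mat 1 \<in> G"
    and mult: "\<And>g h. g \<in> G \<Longrightarrow> h \<in> G \<Longrightarrow> g ** h \<in> G"
begin

lemma compact_G: "compact G"
  using sub closed compact_SO compact_Int_closed[of SO_grp G] by (simp add: Int_absorb1)

lemma power: "g \<in> G \<Longrightarrow> mat_of (sq g ^ k) \<in> G"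
  by (induction k) (auto simp: one mult one_sqmat.rep_eq times_sqmat.rep_eq sq_inverse)

text \<open>By compactness some powers of \<open>g\<close> accumulate, so powers of \<open>g\<close> come back to the identity.\<close>

lemma inverse:
  assumes g: "g \<in> G"
  shows "transpose g \<in> G"
proof -
  define X where "X k = mat_of (sq g ^ k)" for k
  have XG: "X k \<in> G" for k unfolding X_def by (rule power[OF g])
  have Xadd: "X (k + l) = X k ** X l" for k l
    by (simp add: X_def power_add times_sqmat.rep_eq)
  have X1: "X (Suc 0) = g" by (simp add: X_def sq_inverse)
  obtain l r where l: "l \<in> G" and r: "strict_mono (r :: nat \<Rightarrow> nat)" and lim: "(X \<circ> r) \<longlonglongrightarrow> l"
    using compact_G XG unfolding compact_def by metis
  \<comment> \<open>The gap between consecutive return times minus one: \<open>X (m k)\<close> is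
    then the inverse of \<open>g\<close> times a quotient that tends to the identity. The
    subtraction does not truncate because \<open>r\<close> is strictly increasing.\<close>
  define m where "m k = r (Suc k) - r k - 1" for k
  have rm: "r (Suc k) = r k + (Suc 0 + m k)" for k
    using strict_monoD[OF r, of k "Suc k"] by (simp add: m_def)
  have inv: "transpose (X k) ** (X k ** Y) = Y" for k Y
    using XG sub by (auto simp: matrix_mul_assoc SO_left_inverse subset_iff)
  have eq: "X (m k) = transpose g ** (transpose (X (r k)) ** X (r (Suc k)))" for k
    unfolding rm Xadd inv using inv[of "Suc 0" "X (m k)"] unfolding X1 by (rule sym)
  have "(\<lambda>k. transpose g ** (transpose (X (r k)) ** X (r (Suc k)))) \<longlonglongrightarrow> transpose g ** (transpose l ** l)"
    using lim lim[THEN LIMSEQ_Suc]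
    by (auto intro!: tendsto_intros bounded_linear.tendsto[OF bounded_linear_transpose] simp: o_def)
  then have "(\<lambda>k. X (m k)) \<longlonglongrightarrow> transpose g"
    using l sub by (simp add: eq SO_left_inverse subset_iff)
  then show ?thesis by (rule closed_sequentially[OF closed, rotated]) (rule XG)
qed

text \<open>The Lie algebra of \<open>G\<close>, described through one-parameter subgroups.\<close>

definition tangent :: "(real^'n^'n) set" where
  "tangent = {A \<in> so_alg. \<forall>t. mexp (t *\<^sub>R A) \<in> G}"

text \<open>Needed because flows of the system are available for nonnegative times only; the
  transpose supplies the negative ones.\<close>

lemma tangentI_nonneg:
  assumes A: "A \<in> so_alg" and pos: "\<And>t. t \<ge> 0 \<Longrightarrow> mexp (t *\<^sub>R A) \<in> G"
  shows "A \<in> tangent"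
proof -
  have "mexp (t *\<^sub>R A) \<in> G" if "t < 0" for t
    using inverse[OF pos[of "- t"]] that transpose_mexp_skew[OF so_alg_scaleR[OF A, of "- t"]] by simp
  then have "mexp (t *\<^sub>R A) \<in> G" for t using pos[of t] by (cases "t < 0") auto
  then show ?thesis using A by (simp add: tangent_def)
qed

lemma tangent_so_alg: "A \<in> tangent \<Longrightarrow> A \<in> so_alg"
  by (simp add: tangent_def)

lemma tangent_scaleR: "A \<in> tangent \<Longrightarrow> c *\<^sub>R A \<in> tangent"
  by (simp add: tangent_def so_alg_scaleR)

lemma mexp_tangent: "A \<in> tangent \<Longrightarrow> mexp A \<in> G"
  by (auto simp: tangent_def dest: spec[of _ 1])

text \<open>The Lie product formula: \<open>mexp (A + B)\<close> is the limit of the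
  \<open>k\<close>-th powers of \<open>mexp (A / k) ** mexp (B / k)\<close>, and \<open>G\<close> is
  closed.\<close>

lemma mexp_add_tangent:
  assumes A: "A \<in> tangent" and B: "B \<in> tangent"
  shows "mexp (A + B) \<in> G"
proof -
  define f where "f t = mexp (t *\<^sub>R A) ** mexp (t *\<^sub>R B)" for t
  have f: "f t \<in> G" for t unfolding f_def by (intro mult mexp_tangent tangent_scaleR A B)
  have "(f has_vector_derivative A + B) (at 0)"
    unfolding f_def
    using has_vector_derivative_matrix_mult[OF mexp_has_vector_derivative[of A 0] mexp_has_vector_derivative[of B 0]]
    by (simp add: add.commute)
  from has_vector_derivative_sequence[OF this]
  have "(\<lambda>k. real k *\<^sub>R (f (1 / real k) - mat 1)) \<longlonglongrightarrow> A + B" by (simp add: f_def)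
  then have "(\<lambda>k. mat_of (sq (f (1 / real k)) ^ k)) \<longlonglongrightarrow> mexp (A + B)"
    using f sub A B by (intro SO_power_tendsto_mexp so_alg_add) (auto dest: tangent_so_alg)
  then show ?thesis by (rule closed_sequentially[OF closed, rotated]) (rule power[OF f])
qed

lemma tangent_add: "A \<in> tangent \<Longrightarrow> B \<in> tangent \<Longrightarrow> A + B \<in> tangent"
  using mexp_add_tangent[OF tangent_scaleR tangent_scaleR] so_alg_add[OF tangent_so_alg tangent_so_alg]
  by (simp add: tangent_def[THEN eqset_imp_iff, of "A + B"] scaleR_add_right)

lemma tangent_conj:
  assumes g: "g \<in> G" and A: "A \<in> tangent"
  shows "g ** A ** transpose g \<in> tangent"
proof -
  have "mexp (t *\<^sub>R (g ** A ** transpose g)) \<in> G" for t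
  proof -
    have "g ** mexp (t *\<^sub>R A) ** transpose g \<in> G"
      by (intro mult inverse g mexp_tangent tangent_scaleR A)
    moreover have "g ** mexp (t *\<^sub>R A) ** transpose g = mexp (g ** (t *\<^sub>R A) ** transpose g)"
      using g sub by (intro mexp_conj SO_left_inverse) auto
    ultimately show ?thesis by (simp add: matrix_bilinear_simps)
  qed
  then show ?thesis using A by (auto simp: tangent_def so_alg_conj)
qed

lemma givens_G: "Bmat i j \<in> tangent \<Longrightarrow> givens i j t \<in> G"
  by (simp add: givens_def mexp_tangent tangent_scaleR)

lemma tangent_Bmat_sym: "Bmat i j \<in> tangent \<Longrightarrow> Bmat j i \<in> tangent"
  using tangent_scaleR[of "Bmat i j" "-1"] by (simp add: Bmat_swap[of j i])

lemma tangent_Bmat_self: "Bmat i i \<in> tangent"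
proof -
  have "Bmat i i = 0" by (simp add: Bmat_def vec_eq_iff)
  then show ?thesis using one tangentI_nonneg[OF Bmat_so_alg[of i i]] by simp
qed

text \<open>Conjugation by a quarter turn in the plane of \<open>j\<close> and \<open>k\<close>
  replaces \<open>j\<close> by \<open>k\<close>. With reflexivity and symmetry, being joined by a
  controlled plane is an equivalence relation on the indices.\<close>

lemma tangent_Bmat_trans:
  assumes ij: "Bmat i j \<in> tangent" and jk: "Bmat j k \<in> tangent"
  shows "Bmat i k \<in> tangent"
proof (cases "i = j \<or> j = k \<or> i = k")
  case True
  then show ?thesis using assms tangent_Bmat_self by auto
next
  case False
  then show ?thesis
    using tangent_conj[OF givens_G[OF jk, of "- (pi / 2)"] ij] by (simp add: givens_conj_Bmat)
qed

lemma tangent_flip_diff: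
  assumes "Bmat p q \<in> tangent" "A \<in> tangent"
  shows "A - givens p q pi ** A ** transpose (givens p q pi) \<in> tangent"
  using tangent_add[OF assms(2) tangent_scaleR[OF tangent_conj[OF givens_G[OF assms(1)] assms(2)], of "-1"]]
  by simp

text \<open>Rotating a plane by \<open>\<pi>\<close> changes the sign of the entries having exactly one index in that plane.
  Four such rotations isolate the entry \<open>(i, j)\<close> when \<open>i\<close> and \<open>j\<close> lie in disjoint
  triples of controlled indices.\<close>

lemma tangent_Bmat_of_entry:
  assumes A: "A \<in> tangent" and nz: "A $ i $ j \<noteq> 0"
    and i: "Bmat i q \<in> tangent" "Bmat i r \<in> tangent"
    and j: "Bmat j q' \<in> tangent" "Bmat j r' \<in> tangent"
    and dist: "distinct [i, q, r, j, q', r']"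
  shows "Bmat i j \<in> tangent"
proof -
  define \<Phi> where "\<Phi> p q A = A - givens p q pi ** A ** transpose (givens p q pi)" for p q and A :: "real^'n^'n"
  have \<Phi>: "\<Phi> p q A $ a $ b = (if (a = p \<or> a = q) \<noteq> (b = p \<or> b = q) then 2 * A $ a $ b else 0)"
    if "p \<noteq> q" for p q a b and A :: "real^'n^'n"
    using that by (cases "a = p \<or> a = q"; cases "b = p \<or> b = q") (simp_all add: \<Phi>_def givens_pi_conj_nth)
  have skew: "A $ a $ b = - A $ b $ a" for a b by (intro so_alg_nth tangent_so_alg A)
  define C where "C = \<Phi> j r' (\<Phi> j q' (\<Phi> i r (\<Phi> i q A)))"
  have "C \<in> tangent"
    unfolding C_def \<Phi>_def by (intro tangent_flip_diff i j A)
  moreover have "C = (16 * A $ i $ j) *\<^sub>R Bmat i j"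
  proof -
    have "C $ a $ b = ((16 * A $ i $ j) *\<^sub>R Bmat i j) $ a $ b" for a b
    proof -
      have ne: "i \<noteq> q" "i \<noteq> r" "j \<noteq> q'" "j \<noteq> r'" using dist by auto
      \<comment> \<open>If exactly one of \<open>a\<close>, \<open>b\<close> lies in
        \<open>{i, q}\<close> and exactly one in \<open>{i, r}\<close>, then \<open>i\<close> is
        among them or they are \<open>q\<close> and \<open>r\<close>; the latter misses both pairs
        around \<open>j\<close>. The same argument around \<open>j\<close> leaves only
        \<open>i\<close> and \<open>j\<close>. Four doublings give the factor 16.\<close>
      have pick: "((a = j \<or> a = r') \<noteq> (b = j \<or> b = r')) \<and> ((a = j \<or> a = q') \<noteq> (b = j \<or> b = q')) \<and>
          ((a = i \<or> a = r) \<noteq> (b = i \<or> b = r)) \<and> ((a = i \<or> a = q) \<noteq> (b = i \<or> b = q))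
          \<longleftrightarrow> a = i \<and> b = j \<or> a = j \<and> b = i"
        using dist unfolding distinct.simps list.set insert_iff empty_iff by (smt (verit))
      have "C $ a $ b = (if a = i \<and> b = j \<or> a = j \<and> b = i then 16 * A $ a $ b else 0)"
        unfolding C_def \<Phi>[OF ne(1)] \<Phi>[OF ne(2)] \<Phi>[OF ne(3)] \<Phi>[OF ne(4)] pick[symmetric] by argo
      then show ?thesis
        using dist by (cases "a = i \<and> b = j"; cases "a = j \<and> b = i") (auto simp: Bmat_def skew[of j i])
    qed
    then show ?thesis by (simp add: vec_eq_iff)
  qed
  ultimately show ?thesis
    using tangent_scaleR[of C "1 / (16 * A $ i $ j)"] nz by simp
qed

end

section \<open>All plane rotations together generate the rotation group\<close>

text \<open>Taking \<open>(cos t, sin t)\<close> along \<open>(p, q)\<close> gives the value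
  \<open>sqrt (p\<^sup>2 + q\<^sup>2)\<close>, which exceeds \<open>p\<close> unless
  \<open>q = 0\<close>; \<open>t = pi\<close> gives the sign of \<open>p\<close>.\<close>

lemma trig_max_at_zero:
  fixes p q :: real
  assumes "\<And>t. p * cos t + q * sin t \<le> p"
  shows "q = 0" "p \<ge> 0"
proof -
  show "p \<ge> 0" using assms[of pi] by simp
  show "q = 0"
  proof (rule ccontr)
    assume "q \<noteq> 0"
    define \<rho> where "\<rho> = sqrt (p\<^sup>2 + q\<^sup>2)"
    have \<rho>: "\<rho>\<^sup>2 = p\<^sup>2 + q\<^sup>2" "\<rho> > 0"
      using \<open>q \<noteq> 0\<close> by (auto simp: \<rho>_def sum_power2_gt_zero_iff)
    have "(p / \<rho>)\<^sup>2 + (q / \<rho>)\<^sup>2 = (p\<^sup>2 + q\<^sup>2) / \<rho>\<^sup>2"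
      by (simp add: power_divide add_divide_distrib)
    also have "\<dots> = 1" unfolding \<rho>(1)[symmetric] using \<rho>(2) by simp
    finally have "(p / \<rho>)\<^sup>2 + (q / \<rho>)\<^sup>2 = 1" .
    then obtain t where t: "p / \<rho> = cos t" "q / \<rho> = sin t" by (metis sincos_total_2pi)
    have "p * (p / \<rho>) + q * (q / \<rho>) \<le> p" using assms[of t] by (simp add: t)
    then have "\<rho>\<^sup>2 \<le> p * \<rho>" using \<rho> by (simp add: field_simps power2_eq_square)
    then have "\<rho> \<le> p" using \<rho>(2) by (simp add: power2_eq_square)
    then have "\<rho>\<^sup>2 \<le> p\<^sup>2" using \<rho>(2) by (intro power_mono) auto
    then show False using \<rho>(1) \<open>q \<noteq> 0\<close> by simp
  qed
qed

context closed_rotation_semigroup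
begin

text \<open>Given a rotation \<open>g\<close>, maximise \<open>\<Sum>i. w i * h $ i $ i\<close> with distinct positive weights over
  \<open>h \<in> G g G\<close>. The first and second order conditions along plane rotations force \<open>h\<close> to be the identity.\<close>

lemma all_planes_imp_SO:
  assumes all: "\<And>i j. Bmat i j \<in> tangent"
  shows "G = SO_grp"
proof (rule subset_antisym[OF sub], rule subsetI)
  fix g :: "real^'n^'n" assume g: "g \<in> SO_grp"
  \<comment> \<open>An injective numbering of the indices provides distinct weights; adding 1 makes
    them positive.\<close>
  obtain f :: "'n \<Rightarrow> nat" where f: "inj f"
    using finite_imp_inj_to_nat_seg[of "UNIV :: 'n set"] by auto
  define w where "w i = real (f i) + 1" for i
  have wpos: "w i > 0" for i by (simp add: w_def)
  have winj: "w i = w j \<longleftrightarrow> i = j" for i j using f by (simp add: w_def inj_eq)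
  define \<phi> where "\<phi> h = (\<Sum>i\<in>UNIV. w i * h $ i $ i)" for h :: "real^'n^'n"
  define K where "K = (\<lambda>(a, b). a ** g ** b) ` (G \<times> G)"
  have "compact K"
    unfolding K_def
    by (intro compact_continuous_image compact_Times compact_G)
       (auto simp: case_prod_unfold intro!: continuous_intros)
  moreover have "K \<noteq> {}" using one by (auto simp: K_def)
  moreover have "continuous_on K \<phi>" unfolding \<phi>_def by (intro continuous_intros)
  ultimately obtain h where h: "h \<in> K" and max: "\<And>y. y \<in> K \<Longrightarrow> \<phi> y \<le> \<phi> h"
    using continuous_attains_sup[of K \<phi>] by blast
  from h obtain a b where ab: "a \<in> G" "b \<in> G" and hab: "h = a ** g ** b" by (auto simp: K_def)
  have aSO: "a \<in> SO_grp" and bSO: "b \<in> SO_grp" using ab sub by auto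
  then have hSO: "h \<in> SO_grp" unfolding hab by (intro SO_mult g)
  have Kleft: "R ** h \<in> K" if "R \<in> G" for R
    using mult[OF that ab(1)] ab(2) by (auto simp: K_def hab matrix_mul_assoc intro!: image_eqI[of _ _ "(R ** a, b)"])
  have Kright: "h ** R \<in> K" if "R \<in> G" for R
    using mult[OF ab(2) that] ab(1) by (auto simp: K_def hab matrix_mul_assoc intro!: image_eqI[of _ _ "(a, b ** R)"])
  have proj_left: "(plane_proj i j ** h) $ k $ k = (if k = i \<or> k = j then h $ k $ k else 0)" for i j k
    by (simp add: matrix_matrix_mult_def plane_proj_def if_distrib[where f = "\<lambda>x. x * _"] cong: if_cong)
  have proj_right: "(h ** plane_proj i j) $ k $ k = (if k = i \<or> k = j then h $ k $ k else 0)" for i j k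
    by (simp add: matrix_matrix_mult_def plane_proj_def if_distrib[where f = "\<lambda>x. _ * x"] cong: if_cong)
  have \<phi>_add: "\<phi> (x + y) = \<phi> x + \<phi> y" and \<phi>_scale: "\<phi> (c *\<^sub>R x) = c * \<phi> x" for x y c
    by (simp_all add: \<phi>_def algebra_simps sum.distrib sum_distrib_left)
  have \<phi>_proj: "\<phi> (plane_proj i j ** h) = w i * h $ i $ i + w j * h $ j $ j"
      "\<phi> (h ** plane_proj i j) = w i * h $ i $ i + w j * h $ j $ j" if "i \<noteq> j" for i j
  proof -
    have "(\<Sum>k\<in>UNIV. w k * (if k = i \<or> k = j then h $ k $ k else 0))
      = (\<Sum>k\<in>UNIV. (if k = i then w k * h $ k $ k else 0) + (if k = j then w k * h $ k $ k else 0))"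
      using that by (intro sum.cong) auto
    then show "\<phi> (plane_proj i j ** h) = w i * h $ i $ i + w j * h $ j $ j"
      "\<phi> (h ** plane_proj i j) = w i * h $ i $ i + w j * h $ j $ j"
      by (simp_all add: \<phi>_def proj_left proj_right sum.distrib)
  qed
  have \<phi>_B: "\<phi> (Bmat i j ** h) = w i * h $ j $ i - w j * h $ i $ j"
      "\<phi> (h ** Bmat i j) = w j * h $ j $ i - w i * h $ i $ j" for i j
    by (simp_all add: \<phi>_def Bmat_mult_nth mult_Bmat_nth right_diff_distrib sum_subtractf
        if_distrib[where f = "\<lambda>x. _ * x"] cong: if_cong)
  \<comment> \<open>Along a plane rotation, \<open>\<phi>\<close> is a constant plus a combination
    of \<open>cos t\<close> and \<open>sin t\<close>, maximal at \<open>t = 0\<close>. Rotating on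
    the left and on the right gives two different first order equations, which together force
    off-diagonal entries to vanish.\<close>
  have crit: "w i * h $ j $ i = w j * h $ i $ j" "w j * h $ j $ i = w i * h $ i $ j"
      "w i * h $ i $ i + w j * h $ j $ j \<ge> 0" if "i \<noteq> j" for i j
  proof -
    define p where "p = w i * h $ i $ i + w j * h $ j $ j"
    have eq0: "\<phi> (givens i j t ** h) = \<phi> h + (cos t - 1) * p + sin t * (w i * h $ j $ i - w j * h $ i $ j)" for t
      using that by (simp add: givens_eq matrix_add_rdistrib matrix_bilinear_simps \<phi>_add \<phi>_scale \<phi>_proj \<phi>_B p_def)
    have "p * cos t + (w i * h $ j $ i - w j * h $ i $ j) * sin t \<le> p" for t
      using max[OF Kleft[OF givens_G[OF all, of i j t]]] eq0[of t] by (simp add: algebra_simps)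
    note 1 = trig_max_at_zero[OF this]
    have eq1: "\<phi> (h ** givens i j t) = \<phi> h + (cos t - 1) * p + sin t * (w j * h $ j $ i - w i * h $ i $ j)" for t
      using that by (simp add: givens_eq matrix_add_ldistrib matrix_bilinear_simps \<phi>_add \<phi>_scale \<phi>_proj \<phi>_B p_def)
    have "p * cos t + (w j * h $ j $ i - w i * h $ i $ j) * sin t \<le> p" for t
      using max[OF Kright[OF givens_G[OF all, of i j t]]] eq1[of t] by (simp add: algebra_simps)
    note 2 = trig_max_at_zero[OF this]
    show "w i * h $ j $ i = w j * h $ i $ j" "w j * h $ j $ i = w i * h $ i $ j"
      "w i * h $ i $ i + w j * h $ j $ j \<ge> 0"
      using 1 2 by (simp_all add: p_def)
  qed
  have off: "h $ i $ j = 0" if "i \<noteq> j" for i j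
  proof -
    have "(w i)\<^sup>2 * h $ i $ j = (w j)\<^sup>2 * h $ i $ j"
      using crit[OF that] by (metis mult.assoc mult.left_commute power2_eq_square)
    moreover have "(w i)\<^sup>2 \<noteq> (w j)\<^sup>2"
      using winj[of i j] that wpos[of i] wpos[of j] by (simp add: power2_eq_iff_nonneg less_imp_le)
    ultimately show ?thesis by simp
  qed
  have diag_sq: "(h $ i $ i)\<^sup>2 = 1" for i
  proof -
    have "h $ k $ i * h $ k $ i = (if k = i then (h $ i $ i)\<^sup>2 else 0)" for k
      using off[of k i] by (simp add: power2_eq_square)
    then have "(transpose h ** h) $ i $ i = (h $ i $ i)\<^sup>2"
      by (simp add: matrix_matrix_mult_def transpose_def)
    then show ?thesis using hSO by (simp add: SO_left_inverse mat_def)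
  qed
  have det: "(\<Prod>i\<in>UNIV. h $ i $ i) = 1"
    using hSO det_diagonal[of h] off by (simp add: SO_grp_def)
  \<comment> \<open>By the second order condition two diagonal entries cannot both be
    \<open>-1\<close>, as weights are positive; a single \<open>-1\<close> would make the
    determinant \<open>-1\<close>.\<close>
  have diag: "h $ i $ i = 1" for i
  proof (rule ccontr)
    assume "h $ i $ i \<noteq> 1"
    then have i: "h $ i $ i = - 1" using diag_sq[of i] by (simp add: power2_eq_1_iff)
    have "h $ j $ j = 1" if "j \<noteq> i" for j
    proof (rule ccontr)
      assume "h $ j $ j \<noteq> 1"
      then have "h $ j $ j = - 1" using diag_sq[of j] by (simp add: power2_eq_1_iff)
      then show False using crit(3)[of i j] that i wpos[of i] wpos[of j] by simp
    qed
    then have "(\<Prod>k\<in>UNIV - {i}. h $ k $ k) = 1" by (intro prod.neutral) auto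
    then show False using det i prod.remove[of UNIV i "\<lambda>k. h $ k $ k"] by simp
  qed
  have "h = mat 1" using off diag by (simp add: vec_eq_iff mat_def)
  then have "g = transpose a ** transpose b"
    using hab SO_left_inverse[OF aSO] SO_right_inverse[OF bSO]
    by (metis matrix_mul_assoc matrix_mul_lid matrix_mul_rid)
  then show "g \<in> G" using ab by (simp add: mult inverse)
qed

end

section \<open>Dense semigroups generated by a drift and one control\<close>

text \<open>A solution of \<open>g x = y\<close> is a fixed point of \<open>x - N (g x - y)\<close>,
  which maps a small ball into itself because \<open>f\<close> is nearly affine there. Brouwer's
  theorem asks only for continuity of \<open>g\<close>, and one \<open>\<delta>\<close> serves all
  \<open>g\<close> and \<open>y\<close>.\<close>

lemma perturbed_local_surjection:
  fixes f L N :: "'a::euclidean_space \<Rightarrow> 'a"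
  assumes f: "(f has_derivative L) (at 0)"
    and N: "bounded_linear N" and NL: "\<And>x. N (L x) = x" and N0: "\<And>z. N z = 0 \<Longrightarrow> z = 0"
    and r: "r > 0"
  obtains s \<delta> where "0 < s" "s \<le> r" "0 < \<delta>"
    "\<And>g y. continuous_on (cball 0 s) g \<Longrightarrow> (\<And>x. x \<in> cball 0 s \<Longrightarrow> norm (g x - f x) \<le> \<delta>) \<Longrightarrow>
       norm (y - f 0) \<le> \<delta> \<Longrightarrow> \<exists>x\<in>cball 0 s. g x = y"
proof -
  obtain C where C: "C > 0" "\<And>z. norm (N z) \<le> norm z * C"
    using bounded_linear.pos_bounded[OF N] by auto
  have "1 / (2 * C) > 0" using C by simp
  then obtain d where d: "d > 0" "\<And>x. norm x < d \<Longrightarrow> norm (f x - f 0 - L x) \<le> 1 / (2 * C) * norm x"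
    using f unfolding has_derivative_at_alt by (metis diff_zero)
  define s where "s = min r (d / 2)"
  \<comment> \<open>After applying \<open>N\<close>, the linearisation error uses up half of the
    radius \<open>s\<close>, and the errors of \<open>g\<close> and \<open>y\<close> a quarter
    each.\<close>
  define \<delta> where "\<delta> = s / (4 * C)"
  have s: "0 < s" "s \<le> r" "s < d" using r d(1) by (auto simp: s_def)
  show thesis
  proof (rule that[of s \<delta>])
    show "0 < s" "s \<le> r" by fact+
    show "0 < \<delta>" using s C by (simp add: \<delta>_def)
    fix g y
    assume cont: "continuous_on (cball 0 s) g"
      and g: "\<And>x. x \<in> cball 0 s \<Longrightarrow> norm (g x - f x) \<le> \<delta>" and y: "norm (y - f 0) \<le> \<delta>"
    define h where "h x = x - N (g x - y)" for x
    have "h \<in> cball 0 s \<rightarrow> cball 0 s"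
    proof
      fix x :: 'a assume x: "x \<in> cball 0 s"
      have "h x = N (L x) - N (g x - y)" by (simp add: h_def NL)
      also have "\<dots> = N (L x - (g x - y))" by (simp add: linear_diff[OF bounded_linear.linear[OF N]])
      also have "L x - (g x - y) = - (f x - f 0 - L x) + - (g x - f x) + (y - f 0)" by simp
      finally have "norm (h x) \<le> norm (- (f x - f 0 - L x) + - (g x - f x) + (y - f 0)) * C"
        using C(2) by simp
      also have "\<dots> \<le> (1 / (2 * C) * s + \<delta> + \<delta>) * C"
      proof (intro mult_right_mono norm_triangle_le add_mono)
        have "norm (f x - f 0 - L x) \<le> 1 / (2 * C) * norm x" using x s by (intro d) simp
        also have "\<dots> \<le> 1 / (2 * C) * s" using x C by (intro mult_left_mono) auto
        finally show "norm (- (f x - f 0 - L x)) \<le> 1 / (2 * C) * s" by (simp add: norm_minus_commute)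
        show "norm (- (g x - f x)) \<le> \<delta>" using g[OF x] by (simp only: norm_minus_cancel)
      qed (use y C in auto)
      also have "\<dots> = s" using C by (simp add: \<delta>_def field_simps)
      finally show "h x \<in> cball 0 s" by simp
    qed
    moreover have "continuous_on (cball 0 s) h"
      unfolding h_def by (intro continuous_intros bounded_linear.continuous_on[OF N] cont)
    ultimately obtain x where x: "x \<in> cball 0 s" "h x = x"
      using brouwer_ball[OF s(1), of 0 h] by blast
    then have "N (g x - y) = 0" by (simp add: h_def)
    then have "g x - y = 0" by (rule N0)
    then show "\<exists>x\<in>cball 0 s. g x = y" using x by auto
  qed
qed

text \<open>Rotations have operator norm at most 1, so approximation errors of the factors add up
  without amplification.\<close>

lemma dist_sq_mult_SO:
  assumes "X \<in> SO_grp" "Y' \<in> SO_grp"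
  shows "dist (sq (X ** Y)) (sq (X' ** Y')) \<le> dist (sq X) (sq X') + dist (sq Y) (sq Y')"
proof -
  have "sq (X ** Y) - sq (X' ** Y') = sq X * (sq Y - sq Y') + (sq X - sq X') * sq Y'"
    by (simp add: algebra_simps flip: times_sqmat.abs_eq)
  also have "norm \<dots> \<le> norm (sq Y - sq Y') + norm (sq X - sq X')"
    using norm_sq_SO[OF assms(1)] norm_sq_SO[OF assms(2)]
    by (intro norm_triangle_le add_mono order_trans[OF norm_mult_ineq]
        mult_left_le_one_le mult_right_le_one_le) auto
  finally show ?thesis by (simp add: dist_norm)
qed

text \<open>A symmetric rotation squares to the identity, so \<open>T ** T = - 2 T\<close>; taking
  norms, \<open>T\<close> is \<open>0\<close> or has norm at least 2. This removes the auxiliary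
  symmetric factor from the local coordinates.\<close>

lemma SO_symmetric_near_one:
  assumes U: "mat 1 + T \<in> SO_grp" and sym: "transpose T = T" and small: "norm (sq T) < 2"
  shows "T = 0"
proof -
  have "transpose (mat 1 + T) = mat 1 + T"
    using sym by (simp add: linear_add[OF bounded_linear.linear[OF bounded_linear_transpose]])
  then have "(mat 1 + T) ** (mat 1 + T) = mat 1" using SO_left_inverse[OF U] by simp
  then have "sq (mat 1 + T) * sq (mat 1 + T) = sq (mat 1)" by (simp add: times_sqmat.abs_eq)
  then have "(1 + sq T) * (1 + sq T) = 1"
    by (simp add: one_sqmat_def flip: plus_sqmat.abs_eq)
  then have "sq T * sq T = - (2 *\<^sub>R sq T)" by (simp add: algebra_simps scaleR_2)  (metis add_eq_0_iff add.assoc)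
  then have "2 * norm (sq T) \<le> norm (sq T) * norm (sq T)"
    using norm_mult_ineq[of "sq T" "sq T"] by simp
  then have "norm (sq T) = 0" using small
    by (metis mult_right_less_imp_less norm_ge_zero not_less order_antisym_conv mult_strict_right_mono)
  then show ?thesis by (simp add: zero_sqmat_def sq_inject)
qed

section \<open>Exponential coordinates of the second kind near the identity\<close>

fun givens_prod :: "('n::finite \<times> 'n) list \<Rightarrow> real^'n^'n \<Rightarrow> real^'n^'n" where
  "givens_prod [] M = mat 1"
| "givens_prod ((i, j) # ps) M = givens i j (M $ i $ j) ** givens_prod ps M"

lemma givens_prod_SO: "givens_prod ps M \<in> SO_grp"
  by (induction ps M rule: givens_prod.induct) (auto intro: SO_mult givens_SO)

lemma givens_0 [simp]: "givens i j 0 = mat 1"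
  by (simp add: givens_def)

lemma givens_prod_0 [simp]: "givens_prod ps 0 = mat 1"
  by (induction ps) auto

lemma givens_prod_has_derivative:
  "(givens_prod ps has_derivative (\<lambda>M. \<Sum>(i, j)\<leftarrow>ps. M $ i $ j *\<^sub>R Bmat i j)) (at 0)"
proof (induction ps)
  case (Cons ij ps)
  obtain i j where ij: "ij = (i, j)" by fastforce
  have "((\<lambda>M :: real^'a^'a. M $ i $ j) has_derivative (\<lambda>M. M $ i $ j)) (at 0)"
    by (intro bounded_linear_imp_has_derivative bounded_linear_compose[OF bounded_linear_vec_nth bounded_linear_vec_nth])
  moreover have "(givens i j has_derivative (\<lambda>t. t *\<^sub>R Bmat i j)) (at ((0 :: real^'a^'a) $ i $ j))"
    using mexp_has_vector_derivative[of "Bmat i j" 0]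
    by (simp add: givens_def[abs_def] has_vector_derivative_def)
  ultimately have "((\<lambda>M. givens i j (M $ i $ j)) has_derivative (\<lambda>M. M $ i $ j *\<^sub>R Bmat i j)) (at (0 :: real^'a^'a))"
    by (rule has_derivative_compose)
  from bounded_bilinear.FDERIV[OF bounded_bilinear_matrix_matrix_mult this Cons.IH]
  show ?case by (simp add: ij add.commute)
qed simp

text \<open>The strictly upper triangular entries of \<open>M\<close> are the angles of the plane rotations. The remaining
  entries parametrise a symmetric factor \<open>mat 1 + sym_of_lower M\<close>, transverse to the rotation group, so that
  the inverse of the derivative can be taken in the space of all matrices and no charts are needed.\<close>

type_synonym 'n rmat = "((real, 'n) vec, 'n) vec"

definition sym_of_lower :: "'n::{finite,linorder} rmat \<Rightarrow> 'n rmat" where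
  "sym_of_lower M = (\<chi> a b. M $ max a b $ min a b)"

lemma transpose_sym_of_lower: "transpose (sym_of_lower M) = sym_of_lower M"
  by (simp add: transpose_def sym_of_lower_def vec_eq_iff max.commute min.commute)

lemma bounded_linear_sym_of_lower: "bounded_linear sym_of_lower"
  by (rule linear_conv_bounded_linear[THEN iffD1]) (auto simp: linear_iff sym_of_lower_def vec_eq_iff)

text \<open>The inverse of the linearised coordinates: above the diagonal it reads off the skew
  part, elsewhere the symmetric part.\<close>

definition entries_of :: "'n::{finite,linorder} rmat \<Rightarrow> 'n rmat" where
  "entries_of Y = (\<chi> a b. if a < b then (Y $ a $ b - Y $ b $ a) / 2 else (Y $ a $ b + Y $ b $ a) / 2)"

lemma bounded_linear_entries_of: "bounded_linear entries_of"
  by (rule linear_conv_bounded_linear[THEN iffD1])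
     (auto simp: linear_iff entries_of_def vec_eq_iff field_simps)

lemma entries_of_eq_0:
  assumes "entries_of Z = 0"
  shows "Z = 0"
proof -
  have "Z $ a $ b = 0" for a b
  proof -
    have "entries_of Z $ a $ b = 0" "entries_of Z $ b $ a = 0" using assms by auto
    then show ?thesis by (cases a b rule: linorder_cases) (auto simp: entries_of_def split: if_splits dest: less_asym)
  qed
  then show ?thesis by (simp add: vec_eq_iff)
qed

lemma entries_of_skew_plus_sym:
  fixes M :: "'n::{finite,linorder} rmat"
  assumes "distinct ps" "set ps = {(i, j). i < j}"
  shows "entries_of ((\<Sum>(i, j)\<leftarrow>ps. M $ i $ j *\<^sub>R Bmat i j) + sym_of_lower M) = M"
proof -
  define K where "K = (\<Sum>(i, j)\<leftarrow>ps. M $ i $ j *\<^sub>R Bmat i j)"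
  have "K $ a $ b = (if a < b then M $ a $ b else 0) - (if b < a then M $ b $ a else 0)" for a b
  proof -
    have "K = (\<Sum>x\<in>{(i, j). i < j}. M $ fst x $ snd x *\<^sub>R Bmat (fst x) (snd x))"
      using sum_list_distinct_conv_sum_set[OF assms(1)] assms(2) by (simp add: K_def case_prod_unfold)
    then have "K $ a $ b = (\<Sum>x\<in>{(i, j). i < j}. M $ fst x $ snd x * Bmat (fst x) (snd x) $ a $ b)" by simp
    also have "\<dots> = (\<Sum>x\<in>{(i, j). i < j}. (if x = (a, b) then M $ a $ b else 0) - (if x = (b, a) then M $ b $ a else 0))"
    proof (rule sum.cong[OF refl])
      fix x :: "'n \<times> 'n" assume "x \<in> {(i, j). i < j}"
      then obtain i j where x: "x = (i, j)" "i \<noteq> j" by auto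
      consider "a = i" "b = j" | "a = j" "b = i" | "x \<noteq> (a, b)" "x \<noteq> (b, a)" using x by blast
      then show "M $ fst x $ snd x * Bmat (fst x) (snd x) $ a $ b
          = (if x = (a, b) then M $ a $ b else 0) - (if x = (b, a) then M $ b $ a else 0)"
      proof cases
        case 3
        then have "\<not> (a = i \<and> b = j)" "\<not> (a = j \<and> b = i)" using x by blast+
        then have "Bmat i j $ a $ b = (0 :: real)"
          unfolding Bmat_def vec_lambda_beta by (simp only: if_False diff_self)
        then show ?thesis using 3 by (simp only: x(1) fst_conv snd_conv if_False mult_zero_right diff_self)
      qed (use x in \<open>simp_all add: Bmat_def\<close>)
    qed
    finally show ?thesis by (simp add: sum_subtractf)
  qed
  then have "entries_of (K + sym_of_lower M) $ a $ b = M $ a $ b" for a b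
    by (cases a b rule: linorder_cases) (auto simp: entries_of_def sym_of_lower_def)
  then show ?thesis by (simp add: K_def vec_eq_iff)
qed

section \<open>From density to equality\<close>

text \<open>The assumption \<open>flow\<close> expresses unbounded controls: any angle
  \<open>\<theta>\<close>, of either sign, can be reached in any positive time
  \<open>\<epsilon>\<close>, at the price of some drift.\<close>

locale drift_control_semigroup =
  fixes S :: "('n::{finite,linorder} rmat) set" and B0 :: "'n rmat" and p q :: 'n
  assumes sub: "S \<subseteq> SO_grp" and one: "mat 1 \<in> S"
    and mult: "\<And>g h. g \<in> S \<Longrightarrow> h \<in> S \<Longrightarrow> g ** h \<in> S"
    and pq: "p \<noteq> q"
    and flow: "\<And>\<epsilon> \<theta>. \<epsilon> > 0 \<Longrightarrow> mexp (\<epsilon> *\<^sub>R B0 + \<theta> *\<^sub>R Bmat p q) \<in> S"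
    and dense: "closure S = SO_grp"
begin

lemma dense_approx:
  assumes "g \<in> SO_grp" "\<delta> > 0"
  obtains s where "s \<in> S" "dist (sq s) (sq g) < \<delta>"
proof -
  obtain K where K: "K > 0" "\<And>x :: 'n rmat. norm (sq x) \<le> norm x * K"
    using bounded_linear.pos_bounded[OF bounded_linear_sq] by auto
  have "g \<in> closure S" "\<delta> / K > 0" using assms K dense by auto
  then obtain s where s: "s \<in> S" "dist s g < \<delta> / K" unfolding closure_approachable by blast
  have "dist (sq s) (sq g) \<le> dist s g * K"
    using K(2)[of "s - g"] by (simp add: dist_norm minus_sqmat.abs_eq)
  also have "\<dots> < \<delta>" using s K by (simp add: pos_less_divide_eq)
  finally show ?thesis using s that by blast
qed

text \<open>The approximating curve must be continuous in \<open>t\<close>, since the products built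
  from such curves are fed into Brouwer's theorem; pointwise density would not give this.\<close>

definition approximable :: "(real \<Rightarrow> 'n rmat) \<Rightarrow> bool" where
  "approximable \<gamma> \<longleftrightarrow> (\<forall>\<delta>>0. \<exists>c. continuous_on {-1..1} c \<and>
     (\<forall>t\<in>{-1..1}. c t \<in> S \<and> dist (sq (c t)) (sq (\<gamma> t)) < \<delta>))"

text \<open>The pure control rotation is the case \<open>\<epsilon> = 0\<close> of the flow; uniform
  continuity on a compact rectangle allows a small positive \<open>\<epsilon>\<close> for all angles
  at once.\<close>

lemma approximable_control: "approximable (givens p q)"
  unfolding approximable_def
proof (intro allI impI)
  fix \<delta> :: real assume \<delta>: "\<delta> > 0"
  define f where "f = (\<lambda>(\<epsilon>, t). sq (mexp (\<epsilon> *\<^sub>R B0 + t *\<^sub>R Bmat p q)))"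
  have "continuous_on ({0..1} \<times> {-1..1}) f"
    unfolding f_def case_prod_unfold
    by (intro bounded_linear.continuous_on[OF bounded_linear_sq]
        continuous_on_compose2[OF continuous_on_mexp[of UNIV]] continuous_intros) auto
  then have "uniformly_continuous_on ({0..1} \<times> {-1..1}) f"
    by (intro compact_uniformly_continuous compact_Times) auto
  then obtain d where d: "d > 0" "\<And>x y. x \<in> {0..1} \<times> {-1..1} \<Longrightarrow> y \<in> {0..1} \<times> {-1..1} \<Longrightarrow>
      dist x y < d \<Longrightarrow> dist (f x) (f y) < \<delta>"
    using \<delta> unfolding uniformly_continuous_on_def by metis
  define \<epsilon> where "\<epsilon> = min 1 (d / 2)"
  have \<epsilon>: "0 < \<epsilon>" "\<epsilon> \<le> 1" "\<epsilon> < d" using d by (auto simp: \<epsilon>_def)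
  show "\<exists>c. continuous_on {-1..1} c \<and> (\<forall>t\<in>{-1..1}. c t \<in> S \<and> dist (sq (c t)) (sq (givens p q t)) < \<delta>)"
  proof (intro exI[of _ "\<lambda>t. mexp (\<epsilon> *\<^sub>R B0 + t *\<^sub>R Bmat p q)"] conjI ballI)
    show "continuous_on {-1..1} (\<lambda>t. mexp (\<epsilon> *\<^sub>R B0 + t *\<^sub>R Bmat p q))"
      by (intro continuous_on_compose2[OF continuous_on_mexp[of UNIV]] continuous_intros) auto
    fix t :: real assume t: "t \<in> {-1..1}"
    show "mexp (\<epsilon> *\<^sub>R B0 + t *\<^sub>R Bmat p q) \<in> S" by (rule flow[OF \<epsilon>(1)])
    have "dist (f (\<epsilon>, t)) (f (0, t)) < \<delta>"
      using t \<epsilon> by (intro d) (auto simp: dist_prod_def dist_real_def)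
    then show "dist (sq (mexp (\<epsilon> *\<^sub>R B0 + t *\<^sub>R Bmat p q))) (sq (givens p q t)) < \<delta>"
      by (simp add: f_def givens_def)
  qed
qed

text \<open>Density approximates \<open>a\<close> and \<open>b\<close> independently, so
  \<open>S\<close> need not contain inverses of its elements for conjugation to work.\<close>

lemma approximable_conj:
  assumes \<gamma>: "approximable \<gamma>" "\<And>t. \<gamma> t \<in> SO_grp" and a: "a \<in> SO_grp" and b: "b \<in> SO_grp"
  shows "approximable (\<lambda>t. a ** \<gamma> t ** b)"
  unfolding approximable_def
proof (intro allI impI)
  fix \<delta> :: real assume "\<delta> > 0"
  then have \<delta>: "\<delta> / 3 > 0" by simp
  obtain c where c: "continuous_on {-1..1} c" "\<And>t. t \<in> {-1..1} \<Longrightarrow> c t \<in> S"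
      "\<And>t. t \<in> {-1..1} \<Longrightarrow> dist (sq (c t)) (sq (\<gamma> t)) < \<delta> / 3"
    using \<gamma> \<delta> unfolding approximable_def by metis
  obtain a' where a': "a' \<in> S" "dist (sq a') (sq a) < \<delta> / 3" by (rule dense_approx[OF a \<delta>])
  obtain b' where b': "b' \<in> S" "dist (sq b') (sq b) < \<delta> / 3" by (rule dense_approx[OF b \<delta>])
  show "\<exists>c. continuous_on {-1..1} c \<and> (\<forall>t\<in>{-1..1}. c t \<in> S \<and> dist (sq (c t)) (sq (a ** \<gamma> t ** b)) < \<delta>)"
  proof (intro exI[of _ "\<lambda>t. a' ** c t ** b'"] conjI ballI)
    show "continuous_on {-1..1} (\<lambda>t. a' ** c t ** b')" by (intro continuous_intros c)
    fix t :: real assume t: "t \<in> {-1..1}"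
    show "a' ** c t ** b' \<in> S" using t by (intro mult a' b' c)
    have SO: "a' \<in> SO_grp" "c t \<in> SO_grp" "b' \<in> SO_grp" using sub a' b' c(2)[OF t] by auto
    have "dist (sq (a' ** c t ** b')) (sq (a ** \<gamma> t ** b)) \<le> dist (sq (a' ** c t)) (sq (a ** \<gamma> t)) + dist (sq b') (sq b)"
      by (intro dist_sq_mult_SO SO_mult SO b)
    also have "dist (sq (a' ** c t)) (sq (a ** \<gamma> t)) \<le> dist (sq a') (sq a) + dist (sq (c t)) (sq (\<gamma> t))"
      by (intro dist_sq_mult_SO SO \<gamma>)
    finally show "dist (sq (a' ** c t ** b')) (sq (a ** \<gamma> t ** b)) < \<delta>"
      using a'(2) b'(2) c(3)[OF t] by linarith
  qed
qed

lemma approximable_reverse: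
  assumes "approximable \<gamma>"
  shows "approximable (\<lambda>t. \<gamma> (- t))"
  unfolding approximable_def
proof (intro allI impI)
  fix \<delta> :: real assume "\<delta> > 0"
  then obtain c where c: "continuous_on {-1..1} c" "\<And>t. t \<in> {-1..1} \<Longrightarrow> c t \<in> S \<and> dist (sq (c t)) (sq (\<gamma> t)) < \<delta>"
    using assms unfolding approximable_def by metis
  show "\<exists>c. continuous_on {-1..1} c \<and> (\<forall>t\<in>{-1..1}. c t \<in> S \<and> dist (sq (c t)) (sq (\<gamma> (- t))) < \<delta>)"
    using c by (intro exI[of _ "\<lambda>t. c (- t)"] conjI ballI continuous_on_compose2[OF c(1)] continuous_intros) auto
qed

lemma approximable_givens_swap: "approximable (givens i j) \<Longrightarrow> approximable (givens j i)"
  using approximable_reverse[of "givens i j"]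
  by (simp add: givens_def[abs_def] Bmat_swap[of j i])

lemma approximable_givens_move:
  assumes ij: "approximable (givens i j)" "i \<noteq> j" and k: "i \<noteq> k"
  shows "approximable (givens i k)"
proof (cases "j = k")
  case False
  define g where "g = givens j k (- (pi / 2))"
  have g: "g \<in> SO_grp" unfolding g_def by (rule givens_SO)
  have "givens i k t = g ** givens i j t ** transpose g" for t
  proof -
    have "g ** givens i j t ** transpose g = mexp (g ** (t *\<^sub>R Bmat i j) ** transpose g)"
      unfolding givens_def[of i j] by (intro mexp_conj SO_left_inverse g)
    also have "g ** (t *\<^sub>R Bmat i j) ** transpose g = t *\<^sub>R Bmat i k"
      using givens_conj_Bmat[of i j k] ij(2) k False by (simp add: g_def matrix_bilinear_simps)
    finally show ?thesis by (simp add: givens_def)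
  qed
  then have "givens i k = (\<lambda>t. g ** givens i j t ** transpose g)" by blast
  then show ?thesis
    using approximable_conj[OF ij(1) givens_SO g SO_transpose[OF g]] by simp
qed (use ij in simp)

text \<open>From the plane of \<open>p\<close> and \<open>q\<close> every plane is reached by
  changing the second index, swapping the two, and changing the second index again.\<close>

lemma approximable_givens:
  assumes "i \<noteq> j"
  shows "approximable (givens i j)"
proof (cases "i = p")
  case True
  then show ?thesis using approximable_givens_move[OF approximable_control pq] assms by simp
next
  case False
  then have "approximable (givens p i)"
    by (intro approximable_givens_move[OF approximable_control pq]) simp
  then have "approximable (givens i p)" by (rule approximable_givens_swap)
  then show ?thesis using approximable_givens_move[of i p j] False assms by blast
qed

lemma givens_prod_approx:
  assumes "\<And>i j. (i, j) \<in> set ps \<Longrightarrow> i \<noteq> j" and "\<delta> > 0"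
  shows "\<exists>\<Gamma>. continuous_on (cball 0 1) \<Gamma> \<and>
    (\<forall>M\<in>cball 0 1. \<Gamma> M \<in> S \<and> dist (sq (\<Gamma> M)) (sq (givens_prod ps M)) < \<delta>)"
  using assms
proof (induction ps arbitrary: \<delta>)
  case Nil
  then show ?case by (intro exI[of _ "\<lambda>_. mat 1"]) (auto simp: one)
next
  case (Cons ij ps)
  obtain i j where ij: "ij = (i, j)" by fastforce
  then have ne: "i \<noteq> j" using Cons.prems by auto
  have \<delta>: "\<delta> / 2 > 0" using Cons.prems by simp
  obtain \<Gamma> where \<Gamma>: "continuous_on (cball 0 1) \<Gamma>" "\<And>M. M \<in> cball 0 1 \<Longrightarrow> \<Gamma> M \<in> S"
      "\<And>M. M \<in> cball 0 1 \<Longrightarrow> dist (sq (\<Gamma> M)) (sq (givens_prod ps M)) < \<delta> / 2"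
    using Cons.IH[OF _ \<delta>] Cons.prems(1) by (metis list.set_intros(2))
  obtain c where c: "continuous_on {-1..1} c" "\<And>t. t \<in> {-1..1} \<Longrightarrow> c t \<in> S"
      "\<And>t. t \<in> {-1..1} \<Longrightarrow> dist (sq (c t)) (sq (givens i j t)) < \<delta> / 2"
    using approximable_givens[OF ne] \<delta> unfolding approximable_def by metis
  have entry: "M $ i $ j \<in> {-1..1}" if "M \<in> cball 0 1" for M :: "'n rmat"
  proof -
    have "\<bar>M $ i $ j\<bar> \<le> norm (M $ i)" by (rule component_le_norm_cart)
    also have "\<dots> \<le> norm M" by (rule Finite_Cartesian_Product.norm_nth_le)
    also have "\<dots> \<le> 1" using that by simp
    finally show ?thesis by (simp add: abs_le_iff)
  qed
  show ?case
  proof (intro exI[of _ "\<lambda>M. c (M $ i $ j) ** \<Gamma> M"] conjI ballI)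
    show "continuous_on (cball 0 1) (\<lambda>M. c (M $ i $ j) ** \<Gamma> M)"
      using entry by (intro continuous_intros \<Gamma>(1) continuous_on_compose2[OF c(1)]) auto
    fix M :: "'n rmat" assume M: "M \<in> cball 0 1"
    show "c (M $ i $ j) ** \<Gamma> M \<in> S" by (intro mult c \<Gamma> entry M)
    have "dist (sq (c (M $ i $ j) ** \<Gamma> M)) (sq (givens i j (M $ i $ j) ** givens_prod ps M))
        \<le> dist (sq (c (M $ i $ j))) (sq (givens i j (M $ i $ j))) + dist (sq (\<Gamma> M)) (sq (givens_prod ps M))"
      using c(2)[OF entry[OF M]] sub by (intro dist_sq_mult_SO givens_prod_SO) auto
    then show "dist (sq (c (M $ i $ j) ** \<Gamma> M)) (sq (givens_prod (ij # ps) M)) < \<delta>"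
      using c(3)[OF entry[OF M]] \<Gamma>(3)[OF M] by (simp add: ij)
  qed
qed

text \<open>Only the rotation factor of \<open>f\<close> is perturbed, to a map into
  \<open>S\<close>. Each \<open>Y\<close> near the identity is then \<open>\<Gamma> M\<close> times
  a symmetric factor; if \<open>Y\<close> is a rotation, that factor is a rotation too, hence the
  identity, and \<open>Y\<close> is \<open>\<Gamma> M\<close>.\<close>

lemma contains_neighbourhood_of_one:
  obtains \<delta> where "\<delta> > 0" "\<And>Y. Y \<in> SO_grp \<Longrightarrow> norm (Y - mat 1) \<le> \<delta> \<Longrightarrow> Y \<in> S"
proof -
  obtain ps where ps: "distinct ps" "set ps = {(i, j). i < (j :: 'n)}"
    using finite_distinct_list[of "{(i, j). i < (j :: 'n)}"] by auto
  let ?T = "sym_of_lower :: 'n rmat \<Rightarrow> 'n rmat"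
  define f where "f M = givens_prod ps M ** (mat 1 + ?T M)" for M
  define L where "L M = (\<Sum>(i, j)\<leftarrow>ps. M $ i $ j *\<^sub>R Bmat i j) + ?T M" for M :: "'n rmat"
  have T0: "?T 0 = 0" by (simp add: sym_of_lower_def vec_eq_iff)
  have "((\<lambda>M. mat 1 + ?T M) has_derivative (\<lambda>M. 0 + ?T M)) (at 0)"
    by (intro has_derivative_add has_derivative_const bounded_linear_imp_has_derivative bounded_linear_sym_of_lower)
  from bounded_bilinear.FDERIV[OF bounded_bilinear_matrix_matrix_mult givens_prod_has_derivative this]
  have f: "(f has_derivative L) (at 0)" by (simp add: f_def[abs_def] L_def[abs_def] T0 add.commute)
  obtain K where K: "K > 0" "\<And>M. norm (sq (?T M)) \<le> norm M * K"
    using bounded_linear.pos_bounded[OF bounded_linear_compose[OF bounded_linear_sq bounded_linear_sym_of_lower]] by auto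
  \<comment> \<open>The bound 1 keeps all angles where the approximations are valid; the bound
    \<open>1 / K\<close> keeps the symmetric part below the threshold 2 of
    \<open>SO_symmetric_near_one\<close>.\<close>
  define r where "r = min 1 (1 / K)"
  have r: "r > 0" "r \<le> 1" using K by (auto simp: r_def)
  obtain s \<delta> where s: "0 < s" "s \<le> r" "0 < \<delta>" and surj:
    "\<And>g y. continuous_on (cball 0 s) g \<Longrightarrow> (\<And>x. x \<in> cball 0 s \<Longrightarrow> norm (g x - f x) \<le> \<delta>) \<Longrightarrow>
       norm (y - f 0) \<le> \<delta> \<Longrightarrow> \<exists>x\<in>cball 0 s. g x = y"
    by (rule perturbed_local_surjection[OF f bounded_linear_entries_of _ entries_of_eq_0 r(1)])
       (auto simp: L_def entries_of_skew_plus_sym[OF ps])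
  have small: "norm (sq (?T M)) \<le> 1" if "M \<in> cball 0 s" for M
  proof -
    have "norm (sq (?T M)) \<le> norm M * K" by (rule K)
    also have "\<dots> \<le> 1 / K * K" using that s K by (intro mult_right_mono) (auto simp: r_def)
    finally show ?thesis using K by simp
  qed
  obtain K' where K': "K' > 0" "\<And>x :: 'n sqmat. norm (mat_of x) \<le> norm x * K'"
    using bounded_linear.pos_bounded[OF bounded_linear_mat_of] by auto
  \<comment> \<open>The 2 bounds the norm of the symmetric factor, and \<open>K'\<close> converts
    the operator norm back to the Euclidean one.\<close>
  have "\<delta> / (2 * K') > 0" using s K' by simp
  from givens_prod_approx[OF _ this, of ps] ps(2)
  obtain \<Gamma> where \<Gamma>: "continuous_on (cball 0 1) \<Gamma>" "\<And>M. M \<in> cball 0 1 \<Longrightarrow> \<Gamma> M \<in> S"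
      "\<And>M. M \<in> cball 0 1 \<Longrightarrow> dist (sq (\<Gamma> M)) (sq (givens_prod ps M)) < \<delta> / (2 * K')"
    by fastforce
  define g where "g M = \<Gamma> M ** (mat 1 + ?T M)" for M
  have ball: "M \<in> cball 0 1" if "M \<in> cball 0 s" for M :: "'n rmat" using that s r by auto
  have "continuous_on (cball 0 s) g"
    unfolding g_def using ball
    by (intro continuous_intros bounded_linear.continuous_on[OF bounded_linear_sym_of_lower]
        continuous_on_subset[OF \<Gamma>(1)]) auto
  moreover have "norm (g M - f M) \<le> \<delta>" if M: "M \<in> cball 0 s" for M
  proof -
    have "g M - f M = mat_of ((sq (\<Gamma> M) - sq (givens_prod ps M)) * (1 + sq (?T M)))"
      by (simp add: g_def f_def times_sqmat.rep_eq minus_sqmat.rep_eq plus_sqmat.rep_eq one_sqmat.rep_eq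
          sq_inverse matrix_bilinear_simps)
    also have "norm \<dots> \<le> norm ((sq (\<Gamma> M) - sq (givens_prod ps M)) * (1 + sq (?T M))) * K'" by (rule K')
    also have "\<dots> \<le> (\<delta> / (2 * K') * 2) * K'"
    proof (intro mult_right_mono order_trans[OF norm_mult_ineq] mult_mono)
      show "norm (sq (\<Gamma> M) - sq (givens_prod ps M)) \<le> \<delta> / (2 * K')"
        using \<Gamma>(3)[OF ball[OF M]] by (simp add: dist_norm)
      show "norm (1 + sq (?T M)) \<le> 2"
        using norm_triangle_ineq[of 1 "sq (?T M)"] small[OF M] by simp
    qed (use K' s in auto)
    also have "\<dots> = \<delta>" using K' by simp
    finally show ?thesis .
  qed
  moreover have f0: "f 0 = mat 1" by (simp add: f_def T0)
  ultimately have onto: "\<exists>M\<in>cball 0 s. g M = Y" if "norm (Y - mat 1) \<le> \<delta>" for Y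
    using surj that by metis
  show thesis
  proof (rule that[OF s(3)])
    fix Y :: "'n rmat" assume Y: "Y \<in> SO_grp" "norm (Y - mat 1) \<le> \<delta>"
    obtain M where M: "M \<in> cball 0 s" "g M = Y" using onto[OF Y(2)] by blast
    have \<Gamma>SO: "\<Gamma> M \<in> SO_grp" using \<Gamma>(2)[OF ball[OF M(1)]] sub by auto
    have "transpose (\<Gamma> M) ** Y = mat 1 + ?T M"
      using SO_left_inverse[OF \<Gamma>SO] by (simp add: g_def matrix_mul_assoc flip: M(2))
    then have "mat 1 + ?T M \<in> SO_grp" using SO_mult[OF SO_transpose[OF \<Gamma>SO] Y(1)] by simp
    then have "?T M = 0"
      using small[OF M(1)] by (intro SO_symmetric_near_one transpose_sym_of_lower) auto
    then show "Y \<in> S" using \<Gamma>(2)[OF ball[OF M(1)]] M(2) by (simp add: g_def)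
  qed
qed

text \<open>Choose \<open>s\<close> in \<open>S\<close> so close to \<open>g\<close> that
  \<open>g ** transpose s\<close> lies in the neighbourhood of the identity contained in
  \<open>S\<close>; then multiply by \<open>s\<close>.\<close>

theorem eq_SO: "S = SO_grp"
proof (rule subset_antisym[OF sub], rule subsetI)
  fix g :: "'n rmat" assume g: "g \<in> SO_grp"
  obtain \<delta> where \<delta>: "\<delta> > 0" and near: "\<And>Y. Y \<in> SO_grp \<Longrightarrow> norm (Y - mat 1) \<le> \<delta> \<Longrightarrow> Y \<in> S"
    using contains_neighbourhood_of_one by blast
  obtain K where K: "K > 0" "\<And>x :: 'n sqmat. norm (mat_of x) \<le> norm x * K"
    using bounded_linear.pos_bounded[OF bounded_linear_mat_of] by auto
  have "\<delta> / K > 0" using \<delta> K by simp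
  then obtain s where s: "s \<in> S" "dist (sq s) (sq g) < \<delta> / K" using dense_approx[OF g] by blast
  then have sSO: "s \<in> SO_grp" using sub by auto
  have "g ** transpose s - mat 1 = mat_of (sq (g ** transpose s) - sq (s ** transpose s))"
    using SO_right_inverse[OF sSO] by (simp add: minus_sqmat.rep_eq sq_inverse)
  also have "norm \<dots> \<le> dist (sq (g ** transpose s)) (sq (s ** transpose s)) * K"
    using K(2) by (simp add: dist_norm)
  also have "\<dots> \<le> (dist (sq g) (sq s) + dist (sq (transpose s)) (sq (transpose s))) * K"
    using K(1) by (intro mult_right_mono dist_sq_mult_SO g SO_transpose sSO) simp
  also have "\<dots> \<le> \<delta>" using s(2) K(1) by (simp add: dist_commute pos_less_divide_eq less_imp_le)
  finally have "g ** transpose s \<in> S" by (intro near SO_mult g SO_transpose sSO)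
  from mult[OF this s(1)] show "g \<in> S"
    using SO_left_inverse[OF sSO] by (simp flip: matrix_mul_assoc)
qed

end

section \<open>The attainable set\<close>

lemma pw_continuous_on_const: "0 \<le> T \<Longrightarrow> pw_continuous_on 0 T (\<lambda>_. c)"
  unfolding pw_continuous_on_def by (intro exI[of _ "{0, T}"]) (auto intro!: exI[of _ "\<lambda>_. c"])

text \<open>The junction \<open>T\<close> is itself a break point, so each gap between neighbouring
  break points lies on one side of it.\<close>

lemma pw_continuous_on_append:
  assumes u: "pw_continuous_on 0 T u" and v: "pw_continuous_on 0 T' v" and T: "0 \<le> T" "0 \<le> T'"
  shows "pw_continuous_on 0 (T + T') (\<lambda>t. if t \<le> T then u t else v (t - T))"
proof -
  obtain S where S: "finite S" "0 \<in> S" "T \<in> S" "S \<subseteq> {0..T}"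
    "\<forall>s\<in>S. \<forall>t\<in>S. s < t \<and> {s<..<t} \<inter> S = {} \<longrightarrow>
      (\<exists>g. continuous_on {s..t} g \<and> (\<forall>x\<in>{s<..<t}. u x = g x))"
    using u unfolding pw_continuous_on_def by (elim exE conjE)
  obtain S' where S': "finite S'" "0 \<in> S'" "T' \<in> S'" "S' \<subseteq> {0..T'}"
    "\<forall>s\<in>S'. \<forall>t\<in>S'. s < t \<and> {s<..<t} \<inter> S' = {} \<longrightarrow>
      (\<exists>g. continuous_on {s..t} g \<and> (\<forall>x\<in>{s<..<t}. v x = g x))"
    using v unfolding pw_continuous_on_def by (elim exE conjE)
  let ?U = "S \<union> (+) T ` S'"
  have "\<exists>g. continuous_on {s..t} g \<and> (\<forall>x\<in>{s<..<t}. (if x \<le> T then u x else v (x - T)) = g x)"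
    if st: "s \<in> ?U" "t \<in> ?U" "s < t" "{s<..<t} \<inter> ?U = {}" for s t
  proof (cases "t \<le> T")
    case True
    have "s \<in> S" "t \<in> S" using st True S(3) S'(4) by auto
    then obtain g where "continuous_on {s..t} g" "\<forall>x\<in>{s<..<t}. u x = g x"
      using S(5)[rule_format, of s t] st by blast
    then show ?thesis using True by (intro exI[of _ g]) auto
  next
    case False
    have "s \<ge> T"
    proof (rule ccontr)
      assume "\<not> s \<ge> T"
      then have "T \<in> {s<..<t} \<inter> ?U" using False S(3) by auto
      then show False using st(4) by blast
    qed
    moreover have "t \<in> (+) T ` S'" using st(2) False S(4) by auto
    moreover have "s \<in> (+) T ` S'"
    proof (cases "s = T")
      case True
      then show ?thesis using S'(2) by (auto intro!: image_eqI[of _ _ 0])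
    next
      case False
      then show ?thesis using st(1) \<open>s \<ge> T\<close> S(4) by auto
    qed
    ultimately obtain s' t' where st': "s = T + s'" "t = T + t'" "s' \<in> S'" "t' \<in> S'" by auto
    have "{s'<..<t'} \<inter> S' = {}"
    proof (rule ccontr)
      assume "\<not> ?thesis"
      then obtain x where "x \<in> S'" "s' < x" "x < t'" by auto
      then have "T + x \<in> {s<..<t} \<inter> ?U" using st' by auto
      then show False using st(4) by blast
    qed
    then obtain g where g: "continuous_on {s'..t'} g" "\<forall>x\<in>{s'<..<t'}. v x = g x"
      using S'(5)[rule_format, of s' t'] st st' by auto
    have "continuous_on {s..t} (\<lambda>x. g (x - T))"
      by (intro continuous_on_compose2[OF g(1)] continuous_intros) (auto simp: st')
    then show ?thesis using g(2) \<open>s \<ge> T\<close> by (intro exI[of _ "\<lambda>x. g (x - T)"]) (auto simp: st')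
  qed
  moreover have "finite ?U" "0 \<in> ?U" "T + T' \<in> ?U" using S(1-3) S'(1-3) by auto
  moreover have "?U \<subseteq> {0..T + T'}"
  proof (rule Un_least)
    show "S \<subseteq> {0..T + T'}" by (rule order_trans[OF S(4)]) (use T in auto)
    show "(+) T ` S' \<subseteq> {0..T + T'}" using S'(4) T by auto
  qed
  ultimately show ?thesis unfolding pw_continuous_on_def by (intro exI[of _ ?U]) blast
qed

text \<open>The system is right invariant: multiplying a solution on the right by the constant
  \<open>X T\<close> gives a solution starting at \<open>X T\<close>.\<close>

lemma is_trajectory_append:
  fixes B0 :: "real^'n::finite^'n"
  assumes X: "is_trajectory B0 Bs u T X" and Y: "is_trajectory B0 Bs v T' Y"
  shows "is_trajectory B0 Bs (\<lambda>i t. if t \<le> T then u i t else v i (t - T)) (T + T')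
    (\<lambda>t. if t \<le> T then X t else Y (t - T) ** X T)"
proof -
  define D where "D u t = B0 + (\<Sum>i<length Bs. u i t *\<^sub>R (Bs ! i))" for u and t :: real
  from X obtain F where X': "0 \<le> T" "X 0 = mat 1" "continuous_on {0..T} X" "\<And>t. t \<in> {0..T} \<Longrightarrow> X t \<in> SO_grp"
      "finite F" "\<And>t. t \<in> {0..T} - F \<Longrightarrow> (X has_vector_derivative D u t ** X t) (at t within {0..T})"
    unfolding is_trajectory_def D_def by blast
  from Y obtain F' where Y': "0 \<le> T'" "Y 0 = mat 1" "continuous_on {0..T'} Y" "\<And>t. t \<in> {0..T'} \<Longrightarrow> Y t \<in> SO_grp"
      "finite F'" "\<And>t. t \<in> {0..T'} - F' \<Longrightarrow> (Y has_vector_derivative D v t ** Y t) (at t within {0..T'})"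
    unfolding is_trajectory_def D_def by blast
  define w where "w i t = (if t \<le> T then u i t else v i (t - T))" for i t
  define Z where "Z t = (if t \<le> T then X t else Y (t - T) ** X T)" for t
  have "continuous_on ({0..T} \<union> {T..T + T'}) Z"
    unfolding Z_def
  proof (rule continuous_on_If)
    show "continuous_on {T..T + T'} (\<lambda>t. Y (t - T) ** X T)"
      by (intro continuous_intros continuous_on_compose2[OF Y'(3)]) auto
  qed (use X' Y' in auto)
  moreover have "{0..T} \<union> {T..T + T'} = {0..T + T'}" using X' Y' by auto
  ultimately have cont: "continuous_on {0..T + T'} Z" by simp
  have SO: "Z t \<in> SO_grp" if "t \<in> {0..T + T'}" for t
    using that X' Y' by (auto simp: Z_def intro!: SO_mult)
  have Z0: "Z 0 = mat 1" using X' by (simp add: Z_def)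
  \<comment> \<open>The junction and both end points join the exceptional times, so that all
    remaining derivatives are two-sided.\<close>
  have deriv: "(Z has_vector_derivative D w t ** Z t) (at t within {0..T + T'})"
    if t: "t \<in> {0..T + T'} - (F \<union> (+) T ` F' \<union> {0, T, T + T'})" for t
  proof (cases "t < T")
    case True
    then have t': "t \<in> {0<..<T}" "t \<notin> F" using t by auto
    have "at t within {0..T} = at t"
      using t' by (intro at_within_interior) (simp add: interior_atLeastAtMost_real)
    then have "(X has_vector_derivative D u t ** X t) (at t)" using X'(6)[of t] t' by auto
    then have "(Z has_vector_derivative D u t ** X t) (at t)"
      by (rule has_vector_derivative_transform_within_open[of _ _ _ "{0<..<T}"]) (use t' in \<open>auto simp: Z_def\<close>)
    moreover have "D w t = D u t" "Z t = X t" using True by (simp_all add: D_def w_def Z_def)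
    ultimately show ?thesis by (simp add: has_vector_derivative_at_within)
  next
    case False
    then have t': "t \<in> {T<..<T + T'}" "t - T \<notin> F'" using t by (auto intro!: image_eqI[of _ _ "t - T"])
    have "at (t - T) within {0..T'} = at (t - T)"
      using t' by (intro at_within_interior) (simp add: interior_atLeastAtMost_real)
    then have "(Y has_vector_derivative D v (t - T) ** Y (t - T)) (at (t - T))" using Y'(6)[of "t - T"] t' by auto
    moreover have "((\<lambda>t. t - T) has_vector_derivative 1) (at t)" by (auto intro!: derivative_eq_intros)
    ultimately have "((\<lambda>t. Y (t - T)) has_vector_derivative D v (t - T) ** Y (t - T)) (at t)"
      using vector_diff_chain_at[of "\<lambda>t. t - T" 1 t Y] by (simp add: o_def)
    from has_vector_derivative_matrix_mult[OF this has_vector_derivative_const[of "X T"]]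
    have "((\<lambda>t. Y (t - T) ** X T) has_vector_derivative D v (t - T) ** Y (t - T) ** X T) (at t)" by simp
    then have "(Z has_vector_derivative D v (t - T) ** Y (t - T) ** X T) (at t)"
      by (rule has_vector_derivative_transform_within_open[of _ _ _ "{T<..<T + T'}"]) (use t' in \<open>auto simp: Z_def\<close>)
    moreover have "D w t = D v (t - T)" "Z t = Y (t - T) ** X T" using t' by (simp_all add: D_def w_def Z_def)
    ultimately show ?thesis by (simp add: has_vector_derivative_at_within matrix_mul_assoc)
  qed
  have "finite (F \<union> (+) T ` F' \<union> {0, T, T + T'})" using X' Y' by simp
  then have "is_trajectory B0 Bs w (T + T') Z"
    unfolding is_trajectory_def using X'(1) Y'(1)
    by (intro conjI ballI exI[of _ "F \<union> (+) T ` F' \<union> {0, T, T + T'}"] add_nonneg_nonneg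
        Z0 cont SO deriv[unfolded D_def])
  then show ?thesis by (simp only: w_def[abs_def] Z_def[abs_def])
qed

lemma attainable_SO: "attainable B0 Bs \<subseteq> SO_grp"
  by (auto simp: attainable_def is_trajectory_def)

lemma attainable_mult:
  assumes "g \<in> attainable B0 Bs" "h \<in> attainable B0 Bs"
  shows "g ** h \<in> attainable B0 Bs"
proof -
  obtain T u X where X: "h = X T" "0 \<le> T" "\<And>i. i < length Bs \<Longrightarrow> pw_continuous_on 0 T (u i)" "is_trajectory B0 Bs u T X"
    using assms(2) unfolding attainable_def by blast
  obtain T' v Y where Y: "g = Y T'" "0 \<le> T'" "\<And>i. i < length Bs \<Longrightarrow> pw_continuous_on 0 T' (v i)" "is_trajectory B0 Bs v T' Y"
    using assms(1) unfolding attainable_def by blast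
  \<comment> \<open>The control reaching \<open>h\<close> runs first. If \<open>T' = 0\<close> the
    first branch applies, and there \<open>g\<close> is the identity.\<close>
  have "(if T + T' \<le> T then X (T + T') else Y (T + T' - T) ** X T) = g ** h"
    using X Y by (auto simp: is_trajectory_def)
  then show ?thesis
    using is_trajectory_append[OF X(4) Y(4)] pw_continuous_on_append[OF X(3) Y(3) X(2) Y(2)] X(2) Y(2)
    unfolding attainable_def
    by (intro CollectI exI[of _ "T + T'"] exI[of _ "\<lambda>i t. if t \<le> T then u i t else v i (t - T)"]
        exI[of _ "\<lambda>t. if t \<le> T then X t else Y (t - T) ** X T"]) auto
qed

lemma mexp_attainable:
  assumes skew: "B0 \<in> so_alg" "set Bs \<subseteq> so_alg" and T: "0 \<le> T"
  shows "mexp (T *\<^sub>R (B0 + (\<Sum>i<length Bs. c i *\<^sub>R (Bs ! i)))) \<in> attainable B0 Bs"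
proof -
  define A where "A = B0 + (\<Sum>i<length Bs. c i *\<^sub>R (Bs ! i))"
  have A: "A \<in> so_alg"
    unfolding A_def using skew by (intro so_alg_add so_alg_sum so_alg_scaleR) auto
  have "continuous_on {0..T} (\<lambda>t. mexp (t *\<^sub>R A))"
    by (rule continuous_on_compose2[OF continuous_on_mexp[of UNIV]]) (auto intro!: continuous_intros)
  moreover have "mexp (t *\<^sub>R A) \<in> SO_grp" for t by (intro mexp_SO so_alg_scaleR A)
  moreover have "((\<lambda>t. mexp (t *\<^sub>R A)) has_vector_derivative A ** mexp (t *\<^sub>R A)) (at t within {0..T})" for t
    by (rule has_vector_derivative_at_within[OF mexp_has_vector_derivative])
  ultimately have "is_trajectory B0 Bs (\<lambda>i _. c i) T (\<lambda>t. mexp (t *\<^sub>R A))"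
    unfolding is_trajectory_def A_def[symmetric] using T by (intro conjI exI[of _ "{}"]) auto
  then show ?thesis
    unfolding attainable_def A_def[symmetric] using T
    by (intro CollectI exI[of _ T] exI[of _ "\<lambda>i _. c i"] exI[of _ "\<lambda>t. mexp (t *\<^sub>R A)"])
       (auto intro: pw_continuous_on_const)
qed

section \<open>Generic drift and the graph argument\<close>

text \<open>The coefficients are powers of a number avoiding the roots of finitely many nonzero polynomials.\<close>

lemma rigid_pattern_generic:
  fixes As :: "(real^'n::finite^'n) set"
  assumes fin: "finite As" and ne: "As \<noteq> {}"
  obtains B where "B \<in> rigid_pattern As" "\<And>i j. (i, j) \<in> drift_rel As \<Longrightarrow> B $ i $ j \<noteq> 0"
proof -
  obtain h where h: "bij_betw h {0..<card As} As" using ex_bij_betw_nat_finite[OF fin] by blast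
  define n where "n = card As - 1"
  have "card As = Suc n" using fin ne by (simp add: n_def card_gt_0_iff)
  then have "{0..<card As} = {..n}" by (simp add: atLeast0LessThan lessThan_Suc_atMost)
  then have h: "bij_betw h {..n} As" using h by simp
  define R where "R i j = {x :: real. (\<Sum>k\<le>n. h k $ i $ j * x ^ k) = 0}" for i j
  have "finite (R i j)" if "(i, j) \<in> drift_rel As" for i j
  proof -
    obtain A where "A \<in> As" "A $ i $ j \<noteq> 0" using \<open>(i, j) \<in> drift_rel As\<close> by (auto simp: drift_rel_def)
    then obtain k where "k \<le> n" "h k $ i $ j \<noteq> 0" using h by (auto simp: bij_betw_def)
    then show ?thesis unfolding R_def by (subst polyfun_finite_roots) auto
  qed
  \<comment> \<open>Excluding \<open>0\<close> makes all coefficients nonzero, as the rigid pattern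
    demands.\<close>
  then have "finite (insert 0 (\<Union>(i, j)\<in>drift_rel As. R i j))" by auto
  then obtain x where x: "x \<notin> insert 0 (\<Union>(i, j)\<in>drift_rel As. R i j)"
    using ex_new_if_finite infinite_UNIV_char_0 by blast
  define B where "B = (\<Sum>g\<in>As. x ^ inv_into {..n} h g *\<^sub>R g)"
  have "B = (\<Sum>k\<le>n. x ^ k *\<^sub>R h k)"
    unfolding B_def using h
    by (subst sum.reindex_bij_betw[OF h, symmetric])
       (auto intro!: sum.cong simp: bij_betw_def)
  then have "B $ i $ j = (\<Sum>k\<le>n. h k $ i $ j * x ^ k)" for i j by (simp add: mult.commute)
  then have "B $ i $ j \<noteq> 0" if "(i, j) \<in> drift_rel As" for i j using x that by (auto simp: R_def)
  moreover have "B \<in> rigid_pattern As"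
    unfolding rigid_pattern_def B_def using x
    by (intro CollectI exI[of _ "\<lambda>g. x ^ inv_into {..n} h g"]) auto
  ultimately show thesis using that by blast
qed

lemma free_pattern_superset:
  assumes "finite S"
  shows "S \<subseteq> free_pattern S"
proof
  fix g assume g: "g \<in> S"
  have "(\<Sum>x\<in>S. (if x = g then 1 else 0) *\<^sub>R x) = (\<Sum>x\<in>S. if x = g then x else 0)"
    by (intro sum.cong) auto
  also have "\<dots> = g" using g assms by simp
  finally show "g \<in> free_pattern S"
    unfolding free_pattern_def by (intro CollectI exI[of _ "\<lambda>x. if x = g then 1 else 0"]) simp
qed

lemma card_ge_3_obtain:
  assumes "card C \<ge> 3"
  obtains q r where "q \<in> C" "r \<in> C" "q \<noteq> i" "r \<noteq> i" "q \<noteq> r"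
proof -
  have "\<not> C \<subseteq> {i}" using assms card_mono[of "{i}" C] by auto
  then obtain q where q: "q \<in> C" "q \<noteq> i" by blast
  have "card {i, q} \<le> 2" by (simp add: card_insert_if)
  then have "\<not> C \<subseteq> {i, q}" using assms card_mono[of "{i, q}" C] by auto
  then show thesis using q that by blast
qed

lemma (in closed_rotation_semigroup) connected_graph_imp_SO:
  assumes B0: "B0 \<in> tangent" and P: "\<And>i j. (i, j) \<in> P \<Longrightarrow> Bmat i j \<in> tangent"
    and drift: "\<And>i j. (i, j) \<in> D \<Longrightarrow> i \<noteq> j \<and> B0 $ i $ j \<noteq> 0"
    and card: "\<And>v. card (component (contr_rel P) v) \<ge> 3"
    and conn: "graph_connected (D \<union> contr_rel P)"
  shows "G = SO_grp"
proof -
  have path: "Bmat i j \<in> tangent" if "(i, j) \<in> R\<^sup>*" "\<And>a b. (a, b) \<in> R \<Longrightarrow> Bmat a b \<in> tangent" for i j R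
    using that(1) by induction (use that(2) tangent_Bmat_self tangent_Bmat_trans in blast)+
  have contr: "Bmat i j \<in> tangent" if "(i, j) \<in> contr_rel P" for i j
    using that P tangent_Bmat_sym by (auto simp: contr_rel_def)
  have comp: "Bmat i j \<in> tangent" if "j \<in> component (contr_rel P) i" for i j
    using that path[OF _ contr] by (simp add: component_def)
  have edge: "Bmat i j \<in> tangent" if ij: "(i, j) \<in> D" for i j
  proof (rule ccontr)
    \<comment> \<open>Under this assumption no index can be joined to both \<open>i\<close> and
      \<open>j\<close>, so the triples chosen around them are automatically disjoint.\<close>
    assume no: "Bmat i j \<notin> tangent"
    obtain q r where qr: "q \<in> component (contr_rel P) i" "r \<in> component (contr_rel P) i" "q \<noteq> i" "r \<noteq> i" "q \<noteq> r"
      using card_ge_3_obtain[OF card] by metis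
    obtain q' r' where qr': "q' \<in> component (contr_rel P) j" "r' \<in> component (contr_rel P) j" "q' \<noteq> j" "r' \<noteq> j" "q' \<noteq> r'"
      using card_ge_3_obtain[OF card] by metis
    have sep: "a \<noteq> b" if "Bmat i a \<in> tangent" "Bmat j b \<in> tangent" for a b
      using no that tangent_Bmat_trans tangent_Bmat_sym by blast
    have "distinct [i, q, r, j, q', r']"
      using qr qr' sep comp[OF qr(1)] comp[OF qr(2)] comp[OF qr'(1)] comp[OF qr'(2)]
        tangent_Bmat_self[of i] tangent_Bmat_self[of j]
      unfolding distinct.simps list.set insert_iff empty_iff by metis
    then have "Bmat i j \<in> tangent"
      using drift[OF ij] by (intro tangent_Bmat_of_entry[OF B0 _ comp[OF qr(1)] comp[OF qr(2)] comp[OF qr'(1)] comp[OF qr'(2)]]) auto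
    then show False using no by simp
  qed
  have "Bmat i j \<in> tangent" for i j
  proof (rule path)
    show "(i, j) \<in> (D \<union> contr_rel P)\<^sup>*" using conn by (simp add: graph_connected_def)
  qed (use edge contr in auto)
  then show ?thesis by (rule all_planes_imp_SO)
qed

theorem theorem1:
  fixes As :: "((real, 'n::{finite,linorder}) vec, 'n) vec set"
    and P :: "('n \<times> 'n) set"
  assumes "CARD('n) \<ge> 2"
    and "finite As" and "As \<noteq> {}" and "As \<subseteq> so_alg"
    and "\<forall>(i, j)\<in>P. i < j"
    and "\<forall>v. card (component (contr_rel P) v) \<ge> 3"
    and "graph_connected (drift_rel As \<union> contr_rel P)"
  shows "struct_controllable_SO (rigid_pattern As) (free_pattern ((\<lambda>(i, j). Bmat i j) ` P))"
proof -
  let ?C = "(\<lambda>(i, j). Bmat i j) ` P :: 'n rmat set"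
  obtain B0 where B0: "B0 \<in> rigid_pattern As" "\<And>i j. (i, j) \<in> drift_rel As \<Longrightarrow> B0 $ i $ j \<noteq> 0"
    using rigid_pattern_generic[OF assms(2,3)] by blast
  have B0_so: "B0 \<in> so_alg"
    using B0(1) assms(4) by (auto simp: rigid_pattern_def intro!: so_alg_sum so_alg_scaleR)
  have finC: "finite ?C" by simp
  then obtain Bs where Bs: "set Bs = ?C" using finite_list by blast
  have Bs_so: "set Bs \<subseteq> so_alg" using Bs by (auto simp: Bmat_so_alg)
  \<comment> \<open>This secures at least one control and the plane \<open>p\<close>,
    \<open>q\<close> used for passing from density to equality.\<close>
  have "P \<noteq> {}"
  proof
    assume "P = {}"
    then have "component (contr_rel P) v = {v}" for v by (simp add: component_def contr_rel_def)
    then show False using assms(6) by simp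
  qed
  then obtain p q where pq: "(p, q) \<in> P" by auto
  define S where "S = attainable B0 Bs"
  \<comment> \<open>The constant control \<open>\<theta> / \<epsilon>\<close> in one channel,
    applied for time \<open>\<epsilon>\<close>.\<close>
  have flow: "mexp (\<epsilon> *\<^sub>R B0 + \<theta> *\<^sub>R Bmat i j) \<in> S" if \<epsilon>: "\<epsilon> > 0" and ij: "(i, j) \<in> P" for \<epsilon> \<theta> i j
  proof -
    obtain k where k: "k < length Bs" "Bs ! k = Bmat i j"
      using ij Bs by (metis (mono_tags, lifting) case_prod_conv image_eqI in_set_conv_nth)
    have "(\<Sum>l<length Bs. (if l = k then \<theta> / \<epsilon> else 0) *\<^sub>R (Bs ! l)) = (\<Sum>l<length Bs. if l = k then (\<theta> / \<epsilon>) *\<^sub>R (Bs ! l) else 0)"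
      by (intro sum.cong) auto
    also have "\<dots> = (\<theta> / \<epsilon>) *\<^sub>R Bmat i j" using k by simp
    finally show ?thesis
      using mexp_attainable[OF B0_so Bs_so, of \<epsilon> "\<lambda>l. if l = k then \<theta> / \<epsilon> else 0"] \<epsilon>
      by (simp add: S_def scaleR_add_right)
  qed
  have drift_flow: "mexp (t *\<^sub>R B0) \<in> S" if "t \<ge> 0" for t
    using mexp_attainable[OF B0_so Bs_so that, of "\<lambda>_. 0"] by (simp add: S_def)
  have SSO: "S \<subseteq> SO_grp" unfolding S_def by (rule attainable_SO)
  have Smult: "g ** h \<in> S" if "g \<in> S" "h \<in> S" for g h
    using that unfolding S_def by (rule attainable_mult)
  have Sone: "mat 1 \<in> S" using drift_flow[of 0] by simp
  interpret G: closed_rotation_semigroup "closure S"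
  proof
    show "closure S \<subseteq> SO_grp" using SSO compact_SO by (intro closure_minimal compact_imp_closed)
    show "mat 1 \<in> closure S" using Sone closure_subset by blast
    fix g h assume "g \<in> closure S" "h \<in> closure S"
    then obtain x y where xy: "\<And>n. x n \<in> S" "x \<longlonglongrightarrow> g" "\<And>n. y n \<in> S" "y \<longlonglongrightarrow> h"
      unfolding closure_sequential by blast
    then have "(\<lambda>n. x n ** y n) \<longlonglongrightarrow> g ** h" by (intro tendsto_matrix_mult)
    moreover have "x n ** y n \<in> S" for n by (intro Smult xy)
    ultimately show "g ** h \<in> closure S"
      unfolding closure_sequential by (intro exI[of _ "\<lambda>n. x n ** y n"]) simp
  qed simp
  \<comment> \<open>Letting the duration tend to 0 at a fixed angle removes the drift in the limit,
    which is why the pure rotation is obtained in the closure of \<open>S\<close>.\<close>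
  have control: "Bmat i j \<in> G.tangent" if ij: "(i, j) \<in> P" for i j
  proof (rule G.tangentI_nonneg[OF Bmat_so_alg])
    fix t :: real
    have "isCont mexp (0 *\<^sub>R B0 + t *\<^sub>R Bmat i j)"
      using continuous_on_mexp[of "UNIV :: 'n rmat set"] by (simp add: continuous_on_eq_continuous_at)
    moreover have "(\<lambda>n. (1 / real (Suc n)) *\<^sub>R B0 + t *\<^sub>R Bmat i j) \<longlonglongrightarrow> 0 *\<^sub>R B0 + t *\<^sub>R Bmat i j"
      by (intro tendsto_intros LIMSEQ_Suc[OF lim_1_over_n])
    ultimately have "(\<lambda>n. mexp ((1 / real (Suc n)) *\<^sub>R B0 + t *\<^sub>R Bmat i j)) \<longlonglongrightarrow> mexp (0 *\<^sub>R B0 + t *\<^sub>R Bmat i j)"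
      by (rule isCont_tendsto_compose)
    moreover have "mexp ((1 / real (Suc n)) *\<^sub>R B0 + t *\<^sub>R Bmat i j) \<in> S" for n
      by (intro flow ij) simp
    ultimately show "mexp (t *\<^sub>R Bmat i j) \<in> closure S"
      unfolding closure_sequential
      by (intro exI[of _ "\<lambda>n. mexp ((1 / real (Suc n)) *\<^sub>R B0 + t *\<^sub>R Bmat i j)"]) simp
  qed
  have "B0 \<in> G.tangent"
    using drift_flow closure_subset by (intro G.tangentI_nonneg B0_so) blast
  then have dense: "closure S = SO_grp"
    using assms(6) control B0(2) assms(7)
    by (intro G.connected_graph_imp_SO[of B0 P "drift_rel As"]) (auto simp: drift_rel_def)
  interpret D: drift_control_semigroup S B0 p q
    using SSO Sone Smult dense flow pq assms(5) by unfold_locales auto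
  have "length Bs \<ge> 1" using Bs pq by (cases Bs) auto
  moreover have "set Bs \<subseteq> free_pattern ?C" unfolding Bs by (rule free_pattern_superset[OF finC])
  moreover have "controllable_SO B0 Bs" using D.eq_SO by (simp add: controllable_SO_def S_def)
  ultimately show ?thesis using B0(1) by (auto simp: struct_controllable_SO_def)
qed

end
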